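(* There is an absolute constant $c>0$ such that the following holds. Let $\mathbf A\in\mathbb R^{n\times n}$ be symmetric with $\|\mathbf A\|_\infty\le 1$ and eigenvalues $\lambda_1(\mathbf A)\ge\dots\ge\lambda_n(\mathbf A)$, and let $\epsilon,\delta\in(0,1)$. Let $0<s\le n$ and let $S\subseteq[n]$ be a random set formed by including each index $i\in[n]$ independently with probability $s/n$. Let $\mathbf A_S$ be the corresponding principal submatrix of $\mathbf A$, with eigenvalues $\lambda_1(\mathbf A_S)\ge\dots\ge\lambda_{|S|}(\mathbf A_S)$. For all $i\in[|S|]$ with $\lambda_i(\mathbf A_S)\ge 0$, let $\tilde\lambda_i(\mathbf A)=\frac ns\lambda_i(\mathbf A_S)$. For all $i\in[|S|]$ with $\lambda_i(\mathbf A_S)<0$, let $\tilde\lambda_{n-(|S|-i)}(\mathbf A)=\frac ns\lambda_i(\mathbf A_S)$. For all other $i\in[n]$, let $\tilde\lambda_i(\mathbf A)=0$. If $$s\ge\frac{c\log n}{\epsilon^4\delta},$$ then with probability at least $1-\delta$, for all $i\in[n]$, $$\lambda_i(\mathbf A)-\epsilon n\le\tilde\lambda_i(\mathbf A)\le\lambda_i(\mathbf A)+\epsilon n.$$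
   Context: $[n]=\{1,\dots,n\}$. $\|\mathbf A\|_\infty$ is the largest magnitude of an entry of $\mathbf A$. $\mathbf A_S$ is the principal submatrix with rows and columns indexed by $S$. Convention: $\log x$ is read as $\max\{1,\ln x\}$. *)

theory Defs
  imports
    "HOL-Probability.Product_PMF"
    "Jordan_Normal_Form.Char_Poly"
    "Jordan_Normal_Form.DL_Submatrix"
begin

definition log1 :: "real \<Rightarrow> real" where
  "log1 x = max 1 (ln x)"

text \<open>Only meaningful for matrices with at least one entry.\<close>

definition max_entry_norm :: "real mat \<Rightarrow> real" where
  "max_entry_norm A = Max {\<bar>A $$ (i, j)\<bar> | i j. i < dim_row A \<and> j < dim_col A}"

text \<open>
  The real eigenvalues, repeated according to their multiplicity as roots of the characteristic
  polynomial, in decreasing order. A symmetric matrix of dimension \<open>n\<close> has exactly \<open>n\<close> of them;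
  see \<open>length_eigenvalues_desc\<close> below.
\<close>

definition eigenvalues_desc :: "real mat \<Rightarrow> real list" where
  "eigenvalues_desc A = rev (sorted_list_of_multiset (proots (char_poly A)))"

text \<open>
  The ranks of the eigenvalues are counted from 1, whereas rows and columns are numbered from 0,
  as is usual for \<open>mat\<close>. So the index set of the rows is \<open>{..<n}\<close>.
\<close>

definition eig :: "real mat \<Rightarrow> nat \<Rightarrow> real" where
  "eig A i = eigenvalues_desc A ! (i - 1)"

abbreviation principal_submatrix :: "real mat \<Rightarrow> nat set \<Rightarrow> real mat" where
  "principal_submatrix A S \<equiv> submatrix A S S"

definition random_subset :: "nat \<Rightarrow> real \<Rightarrow> nat set pmf" where
  "random_subset n p =
     map_pmf (\<lambda>b. {i \<in> {..<n}. b i}) (Pi_pmf {..<n} False (\<lambda>_. bernoulli_pmf p))"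

text \<open>
  The second case is the rule that rank \<open>n - (card S - j)\<close> receives \<open>n / s * eig A\<^sub>S j\<close> when
  \<open>eig A\<^sub>S j < 0\<close>, solved for \<open>j\<close>; see \<open>approx_eig_neg\<close> below.
\<close>

definition approx_eig :: "real mat \<Rightarrow> real \<Rightarrow> nat set \<Rightarrow> nat \<Rightarrow> real" where
  "approx_eig A s S i =
     (let n = dim_row A; m = card S; A\<^sub>S = principal_submatrix A S; j = i + m - n in
      if i \<in> {1..m} \<and> eig A\<^sub>S i \<ge> 0 then real n / s * eig A\<^sub>S i
      else if i \<le> n \<and> n < i + m \<and> eig A\<^sub>S j < 0 then real n / s * eig A\<^sub>S j
      else 0)"


lemma symmetric_complex_eigenvalue_real:
  fixes A :: "real mat"
  assumes A: "A \<in> carrier_mat n n" and sym: "transpose_mat A = A"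
    and ev: "eigenvalue (map_mat complex_of_real A) a"
  shows "a \<in> \<real>"
proof -
  define B where "B = map_mat complex_of_real A"
  have B: "B \<in> carrier_mat n n" using A by (simp add: B_def)
  have symB: "B $$ (i, j) = B $$ (j, i)" if "i < n" "j < n" for i j
  proof -
    have "A $$ (i, j) = transpose_mat A $$ (i, j)" by (simp add: sym)
    also have "\<dots> = A $$ (j, i)" using A that by simp
    finally show ?thesis using A that by (simp add: B_def)
  qed
  have cB: "cnj (B $$ (i, j)) = B $$ (i, j)" if "i < n" "j < n" for i j
    using A that by (simp add: B_def)
  obtain v where v: "v \<in> carrier_vec n" "v \<noteq> 0\<^sub>v n" "B *\<^sub>v v = a \<cdot>\<^sub>v v"
    using ev B unfolding eigenvalue_def eigenvector_def B_def by auto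
  define f where "f i = vec_index v i" for i
  have row: "(\<Sum>j<n. B $$ (i, j) * f j) = a * f i" if "i < n" for i
  proof -
    have "vec_index (B *\<^sub>v v) i = (\<Sum>j<n. B $$ (i, j) * f j)"
      using B v(1) that by (simp add: scalar_prod_def f_def atLeast0LessThan)
    then show ?thesis using v that by (simp add: f_def)
  qed
  define N where "N = (\<Sum>i<n. cnj (f i) * f i)"
  have 1: "(\<Sum>i<n. \<Sum>j<n. cnj (f i) * (B $$ (i, j) * f j)) = a * N"
  proof -
    have "(\<Sum>j<n. cnj (f i) * (B $$ (i, j) * f j)) = a * (cnj (f i) * f i)" if "i < n" for i
      unfolding sum_distrib_left [symmetric] row [OF that] by simp
    then show ?thesis by (simp add: N_def sum_distrib_left)
  qed
  have "cnj a * N = cnj (a * N)"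
    by (simp add: N_def mult.commute)
  also have "\<dots> = (\<Sum>i<n. \<Sum>j<n. f i * (B $$ (i, j) * cnj (f j)))"
    unfolding 1 [symmetric] using cB by simp
  also have "\<dots> = (\<Sum>j<n. \<Sum>i<n. f i * (B $$ (i, j) * cnj (f j)))"
    by (rule sum.swap)
  also have "\<dots> = (\<Sum>j<n. \<Sum>i<n. cnj (f j) * (B $$ (j, i) * f i))"
    using symB by (intro sum.cong) (auto simp: mult_ac)
  also have "\<dots> = a * N" by (rule 1)
  finally have eq: "cnj a * N = a * N" .
  obtain k where k: "k < n" "f k \<noteq> 0"
    using v(1,2) unfolding f_def by (metis eq_vecI carrier_vecD index_zero_vec)
  have "N = complex_of_real (\<Sum>i<n. (cmod (f i))\<^sup>2)"
    unfolding N_def of_real_sum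
    by (intro sum.cong) (simp_all only: complex_norm_square mult.commute)
  moreover have "(\<Sum>i<n. (cmod (f i))\<^sup>2) > 0"
    using k by (intro sum_pos2 [of _ k]) auto
  ultimately have "N \<noteq> 0" by (metis less_irrefl of_real_eq_0_iff)
  with eq have "cnj a = a" by simp
  then show ?thesis by (simp add: Reals_cnj_iff)
qed

lemma length_eigenvalues_desc:
  fixes A :: "real mat"
  assumes A: "A \<in> carrier_mat n n" and sym: "transpose_mat A = A"
  shows "length (eigenvalues_desc A) = n"
proof -
  define B where "B = map_mat complex_of_real A"
  have B: "B \<in> carrier_mat n n" using A by (simp add: B_def)
  obtain as where as: "char_poly B = (\<Prod>a\<leftarrow>as. [:- a, 1:])" "length as = n"
    using char_poly_factorized [OF B] by blast
  have real: "a \<in> \<real>" if "a \<in> set as" for a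
  proof -
    have "poly (char_poly B) a = 0"
      using that unfolding as(1) by (force simp: poly_prod_list prod_list_zero_iff)
    then have "eigenvalue B a" using eigenvalue_root_char_poly [OF B] by simp
    then show ?thesis
      using symmetric_complex_eigenvalue_real [OF A sym] by (simp add: B_def)
  qed
  define bs where "bs = map Re as"
  have as_bs: "as = map complex_of_real bs"
    using real by (simp add: bs_def map_idI)
  have hom: "map_poly complex_of_real (char_poly A) = char_poly B"
    unfolding B_def by (rule of_real_hom.char_poly_hom [OF A, symmetric])
  have eq: "map_poly complex_of_real (\<Prod>b\<leftarrow>xs. [:- b, 1:])
      = (\<Prod>a\<leftarrow>map complex_of_real xs. [:- a, 1:])" for xs
  proof (induction xs)
    case (Cons x xs)
    have mult: "map_poly complex_of_real (p * q) =
        map_poly complex_of_real p * map_poly complex_of_real q" for p q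
      by (rule poly_eqI) (simp add: coeff_map_poly coeff_mult)
    have "map_poly complex_of_real [:- x, 1:] = [:- complex_of_real x, 1:]"
      by (simp add: map_poly_pCons)
    then show ?case
      using Cons by (simp add: mult del: mult_pCons_left)
  qed simp
  have "map_poly complex_of_real (char_poly A)
      = map_poly complex_of_real (\<Prod>b\<leftarrow>bs. [:- b, 1:])"
    by (simp only: hom as(1) eq as_bs [symmetric])
  then have cp: "char_poly A = (\<Prod>b\<leftarrow>bs. [:- b, 1:])"
    by (simp add: poly_eq_iff coeff_map_poly)
  have "proots (\<Prod>b\<leftarrow>xs. [:- b, 1:]) = mset xs" for xs :: "real list"
  proof (induction xs)
    case (Cons x xs)
    have "(\<Prod>b\<leftarrow>xs. [:- b, 1:]) \<noteq> 0" by (auto simp: prod_list_zero_iff)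
    then show ?case using Cons by (simp add: proots_mult del: mult_pCons_left)
  qed simp
  then have "proots (char_poly A) = mset bs" by (simp add: cp)
  then have "length (eigenvalues_desc A) = length bs"
    by (metis eigenvalues_desc_def length_rev mset_sorted_list_of_multiset size_mset)
  then show ?thesis by (simp add: bs_def as(2))
qed

lemma eig_antimono:
  assumes "A \<in> carrier_mat n n" "transpose_mat A = A" "1 \<le> i" "i \<le> j" "j \<le> n"
  shows "eig A j \<le> eig A i"
proof -
  have "sorted_wrt (\<ge>) (eigenvalues_desc A)"
    by (simp add: eigenvalues_desc_def sorted_wrt_rev)
  then show ?thesis
    unfolding eig_def using assms length_eigenvalues_desc [OF assms(1,2)]
    by (cases "i = j") (auto simp: sorted_wrt_iff_nth_less)
qed

lemma principal_submatrix_symmetric: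
  fixes A :: "real mat"
  assumes A: "A \<in> carrier_mat n n" and sym: "transpose_mat A = A" and S: "S \<subseteq> {..<n}"
  shows "principal_submatrix A S \<in> carrier_mat (card S) (card S)"
    and "transpose_mat (principal_submatrix A S) = principal_submatrix A S"
proof -
  have S': "{i. i < n \<and> i \<in> S} = S" using S by auto
  have dims: "dim_row A = n" "dim_col A = n" using A by auto
  show "principal_submatrix A S \<in> carrier_mat (card S) (card S)"
    by (rule carrier_matI) (simp_all only: dim_submatrix dims S')
  have "A $$ (i, j) = A $$ (j, i)" if "i < n" "j < n" for i j
    using arg_cong [OF sym, of "\<lambda>M. M $$ (j, i)"] that dims by simp
  moreover have "pick S i < n" if "i < card S" for i
    using pick_in_set_le [OF that] S by auto
  ultimately show "transpose_mat (principal_submatrix A S) = principal_submatrix A S"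
    unfolding submatrix_def dims S' by (intro eq_matI) auto
qed

lemma approx_eig_nonneg:
  assumes "A \<in> carrier_mat n n" "i \<in> {1..card S}" "eig (principal_submatrix A S) i \<ge> 0"
  shows "approx_eig A s S i = real n / s * eig (principal_submatrix A S) i"
  using assms by (auto simp: approx_eig_def Let_def)

lemma approx_eig_neg:
  assumes A: "A \<in> carrier_mat n n" and sym: "transpose_mat A = A" and S: "S \<subseteq> {..<n}"
    and j: "j \<in> {1..card S}" and neg: "eig (principal_submatrix A S) j < 0"
  shows "approx_eig A s S (n - (card S - j)) = real n / s * eig (principal_submatrix A S) j"
proof -
  define i where "i = n - (card S - j)"
  have "card S \<le> n" using card_mono [OF _ S] by simp
  then have ij: "i + card S - n = j" "j \<le> i" "i \<le> n" "n < i + card S"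
    using j by (auto simp: i_def)
  have "eig (principal_submatrix A S) i \<le> eig (principal_submatrix A S) j" if "i \<in> {1..card S}"
    using eig_antimono [OF principal_submatrix_symmetric [OF A sym S]] j ij that by auto
  then show ?thesis
    using A neg ij unfolding i_def [symmetric] approx_eig_def Let_def by auto
qed

lemma approx_eig_other:
  assumes A: "A \<in> carrier_mat n n" and S: "S \<subseteq> {..<n}"
    and "\<not> (i \<in> {1..card S} \<and> eig (principal_submatrix A S) i \<ge> 0)"
    and "\<not> (\<exists>j\<in>{1..card S}. eig (principal_submatrix A S) j < 0 \<and> i = n - (card S - j))"
  shows "approx_eig A s S i = 0"
proof -
  have m: "card S \<le> n" using card_mono [OF _ S] by simp
  have "\<not> (i \<le> n \<and> n < i + card S \<and> eig (principal_submatrix A S) (i + card S - n) < 0)"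
  proof
    assume *: "i \<le> n \<and> n < i + card S \<and> eig (principal_submatrix A S) (i + card S - n) < 0"
    then have "i + card S - n \<in> {1..card S}" "i = n - (card S - (i + card S - n))"
      using m by auto
    with * assms(4) show False by blast
  qed
  then show ?thesis using assms(1,3) by (auto simp: approx_eig_def Let_def)
qed

end

theory Submission
  imports Defs "HOL-Combinatorics.List_Permutation"
begin

text \<open>
  Write \<open>p = s / n\<close>, let \<open>D\<close> be the diagonal 0-1 matrix of \<open>S\<close> and put \<open>e = \<epsilon> / 5\<close>. Split \<open>A\<close> into
  the part with eigenvalues of modulus at least \<open>e n / 2\<close>, which is \<open>W J W\<^sup>T\<close> with \<open>J\<close> a sign matrix
  and \<open>W\<^sup>T W = \<bar>\<Lambda>\<bar>\<close>, and the rest \<open>M\<close>. Since the rows of \<open>A\<close> have square norm at most \<open>n\<close>, the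
  rows of \<open>W\<close> have square norm at most \<open>2 / e\<close>, and therefore \<open>W\<^sup>T D W - p \<bar>\<Lambda>\<bar>\<close> has expected
  square Frobenius norm at most \<open>4 s / e\<^sup>2\<close>. For the rest, \<open>(D M D)\<^sup>2\<close> is compared with
  \<open>p\<^sup>2 M\<^sup>2\<close> through the errors \<open>M (D - p) M\<close> and \<open>D M (D - p) M D\<close>, whose expected square Frobenius
  norms are at most \<open>s n\<^sup>2\<close> and \<open>O(s\<^sup>3)\<close>. By Markov's inequality all these errors are small as soon as
  \<open>s\<close> is a large multiple of \<open>1 / (\<epsilon>\<^sup>4 \<delta>)\<close>. The eigenvalues are then compared by the min-max principle, and the
  negative ones are treated by passing to \<open>- A\<close>.
\<close>

subsection \<open>The spectral theorem for real symmetric matrices\<close>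

lemma sum_delta_of_bool:
  fixes f :: "'a \<Rightarrow> 'b::semiring_1"
  assumes "finite I" "k \<in> I"
  shows "(\<Sum>i\<in>I. f i * of_bool (i = k)) = f k" "(\<Sum>i\<in>I. f i * of_bool (k = i)) = f k"
    "(\<Sum>i\<in>I. of_bool (i = k) * f i) = f k" "(\<Sum>i\<in>I. of_bool (k = i) * f i) = f k"
proof -
  have "(\<Sum>i\<in>I. f i * of_bool (i = k)) = (\<Sum>i\<in>I. if i = k then f i else 0)"
    by (intro sum.cong) auto
  then show 1: "(\<Sum>i\<in>I. f i * of_bool (i = k)) = f k" using assms by simp
  show "(\<Sum>i\<in>I. f i * of_bool (k = i)) = f k" using 1 by (simp add: eq_commute)
  have "(\<Sum>i\<in>I. of_bool (i = k) * f i) = (\<Sum>i\<in>I. if i = k then f i else 0)"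
    by (intro sum.cong) auto
  then show 2: "(\<Sum>i\<in>I. of_bool (i = k) * f i) = f k" using assms by simp
  show "(\<Sum>i\<in>I. of_bool (k = i) * f i) = f k" using 2 by (simp add: eq_commute)
qed

text \<open>Gaussian elimination, by induction on the equations. It does the dimension counting of
  the min-max arguments: a span contains a nonzero vector orthogonal to any smaller number of given
  vectors.\<close>

lemma homogeneous_system_nontrivial:
  fixes a :: "'j \<Rightarrow> 'q \<Rightarrow> 'f::field"
  assumes "finite R" "finite Q" "card R < card Q"
  shows "\<exists>y. (\<exists>q\<in>Q. y q \<noteq> 0) \<and> (\<forall>j\<in>R. (\<Sum>q\<in>Q. a j q * y q) = 0)"
  using assms
proof (induction R arbitrary: a Q rule: finite_induct)
  case empty
  then obtain q where "q \<in> Q" by fastforce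
  then show ?case by (intro exI [of _ "\<lambda>_. 1"]) auto
next
  case (insert j R)
  show ?case
  proof (cases "\<forall>q\<in>Q. a j q = 0")
    case True
    then show ?thesis using insert.IH [of Q a] insert by auto
  next
    case False
    then obtain q0 where q0: "q0 \<in> Q" "a j q0 \<noteq> 0" by blast
    have "card R < card (Q - {q0})" using insert q0 by simp
    then obtain y where y: "\<exists>q\<in>Q - {q0}. y q \<noteq> 0"
      "\<forall>r\<in>R. (\<Sum>q\<in>Q - {q0}. (a r q - a r q0 * a j q / a j q0) * y q) = 0"
      using insert.IH [of "Q - {q0}" "\<lambda>r q. a r q - a r q0 * a j q / a j q0"] insert.prems by auto
    \<comment> \<open>The pivot unknown \<open>q0\<close> is recovered from equation
      \<open>j\<close>; the reduced coefficients are such that the other equations then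
      hold.\<close>
    define z where "z q = (if q = q0 then - (\<Sum>q\<in>Q - {q0}. a j q * y q) / a j q0 else y q)" for q
    have z: "(\<Sum>q\<in>Q. a r q * z q)
        = (\<Sum>q\<in>Q - {q0}. a r q * y q) - a r q0 * (\<Sum>q\<in>Q - {q0}. a j q * y q) / a j q0" for r
    proof -
      have "(\<Sum>q\<in>Q. a r q * z q) = a r q0 * z q0 + (\<Sum>q\<in>Q - {q0}. a r q * z q)"
        using q0 insert.prems by (simp add: sum.remove)
      also have "(\<Sum>q\<in>Q - {q0}. a r q * z q) = (\<Sum>q\<in>Q - {q0}. a r q * y q)"
        by (intro sum.cong) (auto simp: z_def)
      finally show ?thesis by (simp add: z_def)
    qed
    have "(\<Sum>q\<in>Q. a r q * z q) = 0" if "r \<in> R" for r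
    proof -
      have "(\<Sum>q\<in>Q - {q0}. (a r q - a r q0 * a j q / a j q0) * y q)
        = (\<Sum>q\<in>Q - {q0}. a r q * y q - a r q0 / a j q0 * (a j q * y q))"
        by (intro sum.cong) (auto simp: algebra_simps)
      also have "\<dots> = (\<Sum>q\<in>Q. a r q * z q)"
        unfolding z by (simp add: sum_subtractf sum_distrib_left sum_divide_distrib)
      finally show ?thesis using y(2) that by simp
    qed
    moreover have "(\<Sum>q\<in>Q. a j q * z q) = 0" unfolding z using q0 by simp
    moreover have "\<exists>q\<in>Q. z q \<noteq> 0" using y(1) by (auto simp: z_def)
    ultimately show ?thesis by auto
  qed
qed

text \<open>Vectors are functions on an arbitrary coordinate set, so that vectors on
  \<open>S\<close> need no renumbering; swapping the two arguments gives the columns of a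
  family.\<close>

definition orthonormal :: "'a set \<Rightarrow> 'b set \<Rightarrow> ('a \<Rightarrow> 'b \<Rightarrow> real) \<Rightarrow> bool" where
  "orthonormal J I v \<longleftrightarrow> (\<forall>j\<in>J. \<forall>k\<in>J. (\<Sum>i\<in>I. v j i * v k i) = of_bool (j = k))"

lemma orthonormalD:
  "orthonormal J I v \<Longrightarrow> j \<in> J \<Longrightarrow> k \<in> J \<Longrightarrow> (\<Sum>i\<in>I. v j i * v k i) = of_bool (j = k)"
  by (simp add: orthonormal_def)

lemma orthonormal_subset: "orthonormal J I v \<Longrightarrow> L \<subseteq> J \<Longrightarrow> orthonormal L I v"
  unfolding orthonormal_def by blast

text \<open>For a square matrix \<open>P\<close> with orthonormal rows, the right inverse
  \<open>P\<^sup>T\<close> is also a left inverse.\<close>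

lemma orthonormal_complete:
  fixes v :: "nat \<Rightarrow> nat \<Rightarrow> real"
  assumes "orthonormal {..<n} {..<n} v"
  shows "orthonormal {..<n} {..<n} (\<lambda>i j. v j i)"
proof -
  define P where "P = mat n n (\<lambda>(j, i). v j i)"
  have P: "P \<in> carrier_mat n n" "transpose_mat P \<in> carrier_mat n n" by (simp_all add: P_def)
  have "P * transpose_mat P = 1\<^sub>m n"
    using assms
    by (intro eq_matI) (auto simp: P_def scalar_prod_def orthonormal_def atLeast0LessThan)
  then have *: "transpose_mat P * P = 1\<^sub>m n" by (rule mat_mult_left_right_inverse [OF P])
  show ?thesis unfolding orthonormal_def
  proof (intro ballI)
    fix i k assume ik: "i \<in> {..<n}" "k \<in> {..<n}"
    then have "(transpose_mat P * P) $$ (i, k) = (\<Sum>j<n. v j i * v j k)"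
      by (simp add: P_def scalar_prod_def atLeast0LessThan)
    moreover have "(transpose_mat P * P) $$ (i, k) = of_bool (i = k)" using * ik by simp
    ultimately show "(\<Sum>j<n. v j i * v j k) = of_bool (i = k)" by metis
  qed
qed

lemma transpose_eqD:
  assumes "A \<in> carrier_mat n n" "transpose_mat A = A" "i < n" "k < n"
  shows "A $$ (i, k) = A $$ (k, i)"
proof -
  have "transpose_mat A $$ (i, k) = A $$ (k, i)" using assms(1,3,4) by simp
  then show ?thesis by (simp only: assms(2))
qed

section \<open>Diagonalisation\<close>

text \<open>\<open>length_eigenvalues_desc\<close> supplies \<open>n\<close> real roots of the
  characteristic polynomial, hence at least one eigenvalue; an eigenvector for it is
  normalised.\<close>

lemma symmetric_unit_eigenvector:
  fixes a :: "nat \<Rightarrow> nat \<Rightarrow> real"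
  assumes "\<And>i k. i < n \<Longrightarrow> k < n \<Longrightarrow> a i k = a k i" "n > 0"
  obtains w e where "(\<Sum>i<n. w i * w i) = 1" "\<And>i. i < n \<Longrightarrow> (\<Sum>k<n. a i k * w k) = e * w i"
proof -
  define A where "A = mat n n (\<lambda>(i, k). a i k)"
  have A: "A \<in> carrier_mat n n" by (simp add: A_def)
  have "transpose_mat A = A" using assms(1) by (intro eq_matI) (auto simp: A_def)
  then have "length (eigenvalues_desc A) = n" by (rule length_eigenvalues_desc [OF A])
  then obtain e where "e \<in> set (eigenvalues_desc A)" using assms(2) by fastforce
  then have "e \<in># proots (char_poly A)" by (simp add: eigenvalues_desc_def)
  moreover have "char_poly A \<noteq> 0" using degree_monic_char_poly [OF A] by auto
  ultimately have "poly (char_poly A) e = 0" by simp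
  then have "eigenvalue A e" using eigenvalue_root_char_poly [OF A] by simp
  then obtain x where x: "x \<in> carrier_vec n" "x \<noteq> 0\<^sub>v n" "A *\<^sub>v x = e \<cdot>\<^sub>v x"
    using A unfolding eigenvalue_def eigenvector_def by auto
  define f where "f i = vec_index x i" for i
  have af: "(\<Sum>k<n. a i k * f k) = e * f i" if "i < n" for i
  proof -
    have "vec_index (A *\<^sub>v x) i = (\<Sum>k<n. a i k * f k)"
      using that x(1) by (simp add: A_def f_def scalar_prod_def atLeast0LessThan)
    then show ?thesis using x that by (simp add: f_def)
  qed
  define r where "r = (\<Sum>i<n. f i * f i)"
  obtain k where k: "k < n" "f k \<noteq> 0"
    using x(1,2) unfolding f_def by (metis eq_vecI carrier_vecD index_zero_vec)
  have "0 < f k * f k" using k by (metis not_real_square_gt_zero)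
  then have r: "r > 0" unfolding r_def using k by (intro sum_pos2 [of _ k]) auto
  show ?thesis
  proof
    have "(\<Sum>i<n. f i / sqrt r * (f i / sqrt r)) = (\<Sum>i<n. f i * f i) / r"
      unfolding sum_divide_distrib using r by (intro sum.cong) auto
    then show "(\<Sum>i<n. f i / sqrt r * (f i / sqrt r)) = 1" using r by (simp add: r_def)
    fix i assume "i < n"
    then show "(\<Sum>k<n. a i k * (f k / sqrt r)) = e * (f i / sqrt r)"
      using af [of i] by (simp add: sum_divide_distrib [symmetric])
  qed
qed

text \<open>The Householder reflection that exchanges \<open>w\<close> with the first unit vector; if \<open>w\<close> is that
  vector, then \<open>h = 0\<close> and the junk value \<open>2 / 0 = 0\<close> makes the reflection the identity.\<close>

lemma orthonormal_extension:
  fixes w :: "nat \<Rightarrow> real"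
  assumes w: "(\<Sum>i<n. w i * w i) = 1" and n: "n > 0"
  obtains q where "orthonormal {..<n} {..<n} q" "\<And>i. i < n \<Longrightarrow> q 0 i = w i"
proof -
  define h where "h i = w i - of_bool (i = 0)" for i :: nat
  define c where "c = (\<Sum>i<n. h i * h i)"
  define q where "q j i = of_bool (i = j) - 2 / c * h j * h i" for j i :: nat
  have "c = (\<Sum>i<n. w i * w i - 2 * (w i * of_bool (i = 0)) + of_bool (i = 0) * 1)"
    unfolding c_def by (intro sum.cong) (auto simp: h_def algebra_simps)
  also have "\<dots> = 2 - 2 * w 0"
    using n w by (simp add: sum.distrib sum_subtractf sum_distrib_left [symmetric]
      sum_delta_of_bool del: mult_1_right sum_of_bool_eq)
  finally have c: "c = 2 - 2 * w 0" .
  have "(\<Sum>i<n. q j i * q k i) = of_bool (j = k)" if "j < n" "k < n" for j k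
  proof -
    have "(\<Sum>i<n. q j i * q k i) = (\<Sum>i<n. of_bool (i = j) * of_bool (i = k)
       - (2 / c * h k) * (h i * of_bool (i = j))
       - (2 / c * h j) * (h i * of_bool (i = k)) + (2 / c * 2 / c * h j * h k) * (h i * h i))"
      by (intro sum.cong) (auto simp: q_def algebra_simps)
    also have "\<dots> = of_bool (k = j) - 2 / c * h k * h j - 2 / c * h j * h k + (2 / c * 2 / c * h j * h k) * c"
      using that by (simp only: sum.distrib sum_subtractf sum_distrib_left [symmetric]
        sum_delta_of_bool finite_lessThan lessThan_iff c_def)
    also have "(2 / c * 2 / c * h j * h k) * c = 2 / c * h k * h j + 2 / c * h j * h k"
      by (cases "c = 0") simp_all
    also have "of_bool (k = j) - 2 / c * h k * h j - 2 / c * h j * h k + \<dots> = of_bool (j = k)"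
      by (simp only: eq_commute [of k j])
    finally show ?thesis .
  qed
  then have 1: "orthonormal {..<n} {..<n} q" by (simp add: orthonormal_def)
  have "q 0 i = w i" if "i < n" for i
  proof (cases "c = 0")
    case True
    then have "h i * h i = 0" using that unfolding c_def
      by (subst (asm) sum_nonneg_eq_0_iff) auto
    then show ?thesis using True by (simp add: q_def h_def)
  next
    case False
    \<comment> \<open>\<open>h 0 = w 0 - 1\<close> equals \<open>- c / 2\<close>, so row 0 of the
      reflection is the first unit vector plus \<open>h\<close>, which is \<open>w\<close>.\<close>
    then have "2 / c * h 0 = -1" by (simp add: c h_def field_simps)
    then have "q 0 i = of_bool (i = 0) + h i" by (simp add: q_def)
    then show ?thesis by (simp add: h_def)
  qed
  with 1 show ?thesis using that by blast
qed

text \<open>Deflation: a unit eigenvector \<open>w\<close> is completed to an orthonormal basis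
  \<open>q\<close>, in which the matrix splits into one diagonal entry and a symmetric block of size
  \<open>n\<close>. The induction hypothesis applies to the block.\<close>

lemma spectral_eigenvectors:
  fixes a :: "nat \<Rightarrow> nat \<Rightarrow> real"
  assumes "\<And>i k. i < n \<Longrightarrow> k < n \<Longrightarrow> a i k = a k i"
  shows "\<exists>v lam. orthonormal {..<n} {..<n} v \<and>
    (\<forall>j<n. \<forall>i<n. (\<Sum>k<n. a i k * v j k) = lam j * v j i)"
  using assms
proof (induction n arbitrary: a)
  case 0
  then show ?case by (simp add: orthonormal_def)
next
  case (Suc n)
  obtain w e where w: "(\<Sum>i<Suc n. w i * w i) = 1"
    "\<And>i. i < Suc n \<Longrightarrow> (\<Sum>k<Suc n. a i k * w k) = e * w i"
    using symmetric_unit_eigenvector [of "Suc n" a] Suc.prems by blast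
  obtain q where q: "orthonormal {..<Suc n} {..<Suc n} q" "\<And>i. i < Suc n \<Longrightarrow> q 0 i = w i"
    using orthonormal_extension [OF w(1)] by blast
  note complete = orthonormal_complete [OF q(1)]
  \<comment> \<open>The matrix of \<open>a\<close> in the basis \<open>q\<close>. Column 0 vanishes
    off the diagonal because \<open>q 0 = w\<close> is an eigenvector, and row 0 does so by
    symmetry.\<close>
  define c where "c r s = (\<Sum>i<Suc n. q r i * (\<Sum>k<Suc n. a i k * q s k))" for r s
  have sym: "c r s = c s r" for r s
  proof -
    have "c r s = (\<Sum>k<Suc n. \<Sum>i<Suc n. q r i * (a i k * q s k))"
      unfolding c_def sum_distrib_left by (rule sum.swap)
    also have "\<dots> = c s r" unfolding c_def sum_distrib_left
      using Suc.prems by (intro sum.cong) (auto simp: mult_ac)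
    finally show ?thesis .
  qed
  have c0: "c s 0 = 0" if "s < Suc n" "s > 0" for s
  proof -
    have "c s 0 = (\<Sum>i<Suc n. q s i * (e * q 0 i))"
      unfolding c_def using q(2) w(2) by (intro sum.cong refl) simp
    also have "\<dots> = e * (\<Sum>i<Suc n. q s i * q 0 i)"
      unfolding sum_distrib_left by (intro sum.cong) auto
    also have "\<dots> = 0" using orthonormalD [OF q(1), of s 0] that by simp
    finally show ?thesis .
  qed
  have aq: "(\<Sum>k<Suc n. a i k * q s k) = (\<Sum>r<Suc n. c r s * q r i)" if "i < Suc n" for i s
  proof -
    have "(\<Sum>r<Suc n. c r s * q r i)
      = (\<Sum>r<Suc n. \<Sum>l<Suc n. (\<Sum>k<Suc n. a l k * q s k) * (q r l * q r i))"
      unfolding c_def sum_distrib_right [of _ _ "q _ i"]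
      by (intro sum.cong refl) (simp only: mult_ac)
    also have "\<dots> = (\<Sum>l<Suc n. (\<Sum>k<Suc n. a l k * q s k) * (\<Sum>r<Suc n. q r l * q r i))"
      by (subst sum.swap) (simp only: sum_distrib_left)
    also have "\<dots> = (\<Sum>l<Suc n. (\<Sum>k<Suc n. a l k * q s k) * of_bool (l = i))"
      using orthonormalD [OF complete] that by (intro sum.cong refl) simp
    also have "\<dots> = (\<Sum>k<Suc n. a i k * q s k)"
      using that by (intro sum_delta_of_bool) auto
    finally show ?thesis by simp
  qed
  obtain u mu where u: "orthonormal {..<n} {..<n} u"
    "\<And>j r. j < n \<Longrightarrow> r < n \<Longrightarrow> (\<Sum>s<n. c (Suc r) (Suc s) * u j s) = mu j * u j r"
    using Suc.IH [of "\<lambda>r s. c (Suc r) (Suc s)"] sym by blast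
  define x where "x j i = (\<Sum>r<n. u j r * q (Suc r) i)" for j i
  define v where "v j = (case j of 0 \<Rightarrow> w | Suc j \<Rightarrow> x j)" for j
  define lam where "lam j = (case j of 0 \<Rightarrow> e | Suc j \<Rightarrow> mu j)" for j
  have xq: "(\<Sum>i<Suc n. x j i * q s i) = (case s of 0 \<Rightarrow> 0 | Suc s \<Rightarrow> u j s)" if "s < Suc n" for j s
  proof -
    have "(\<Sum>i<Suc n. x j i * q s i) = (\<Sum>r<n. u j r * (\<Sum>i<Suc n. q (Suc r) i * q s i))"
      unfolding x_def sum_distrib_left sum_distrib_right
      by (subst sum.swap) (simp only: mult.assoc)
    also have "\<dots> = (\<Sum>r<n. u j r * of_bool (Suc r = s))"
      using orthonormalD [OF q(1)] that by (intro sum.cong refl) simp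
    also have "\<dots> = (case s of 0 \<Rightarrow> 0 | Suc s \<Rightarrow> u j s)"
      using that by (cases s) (auto simp: sum_delta_of_bool)
    finally show ?thesis .
  qed
  have wx: "(\<Sum>i<Suc n. x j i * w i) = 0" for j
  proof -
    have "(\<Sum>i<Suc n. x j i * w i) = (\<Sum>i<Suc n. x j i * q 0 i)"
      using q(2) by (intro sum.cong refl) simp
    then show ?thesis using xq [of 0 j] by simp
  qed
  have xx: "(\<Sum>i<Suc n. x j i * x k i) = of_bool (j = k)" if "j < n" "k < n" for j k
  proof -
    have "(\<Sum>i<Suc n. x j i * x k i) = (\<Sum>r<n. u k r * (\<Sum>i<Suc n. x j i * q (Suc r) i))"
      unfolding x_def [of k] sum_distrib_left by (subst sum.swap) (simp only: mult_ac)
    also have "\<dots> = (\<Sum>r<n. u k r * u j r)"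
      using xq by (intro sum.cong refl) simp
    finally show ?thesis using orthonormalD [OF u(1), of k j] that by auto
  qed
  have wx': "(\<Sum>i<Suc n. w i * x j i) = 0" for j using wx by (simp only: mult.commute)
  have "orthonormal {..<Suc n} {..<Suc n} v"
    unfolding orthonormal_def
  proof (intro ballI)
    fix j k assume "j \<in> {..<Suc n}" "k \<in> {..<Suc n}"
    then show "(\<Sum>i<Suc n. v j i * v k i) = of_bool (j = k)"
      using wx [of "j - 1"] wx' [of "k - 1"] w(1) xx [of "j - 1" "k - 1"] unfolding v_def
      by (cases j; cases k) (auto simp del: sum.lessThan_Suc)
  qed
  moreover have "(\<Sum>k<Suc n. a i k * v j k) = lam j * v j i" if "j < Suc n" "i < Suc n" for j i
  proof (cases j)
    case 0
    then show ?thesis using w(2) that by (simp add: v_def lam_def del: sum.lessThan_Suc)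
  next
    case j: (Suc j')
    have "(\<Sum>k<Suc n. a i k * x j' k) = (\<Sum>s<n. u j' s * (\<Sum>k<Suc n. a i k * q (Suc s) k))"
      unfolding x_def sum_distrib_left by (subst sum.swap) (simp only: mult_ac)
    \<comment> \<open>The term \<open>r = 0\<close> drops out, since
      \<open>c 0 (Suc s) = c (Suc s) 0 = 0\<close>.\<close>
    also have "\<dots> = (\<Sum>s<n. u j' s * (\<Sum>r<n. c (Suc r) (Suc s) * q (Suc r) i))"
      unfolding aq [OF that(2)] using c0 sym [of 0]
      by (intro sum.cong refl) (simp del: sum.lessThan_Suc add: sum.lessThan_Suc_shift)
    also have "\<dots> = (\<Sum>r<n. q (Suc r) i * (\<Sum>s<n. c (Suc r) (Suc s) * u j' s))"
      unfolding sum_distrib_left by (subst sum.swap) (simp only: mult_ac)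
    also have "\<dots> = (\<Sum>r<n. q (Suc r) i * (mu j' * u j' r))"
      using u(2) that j by (intro sum.cong refl) simp
    also have "\<dots> = mu j' * x j' i"
      unfolding x_def sum_distrib_left by (simp only: mult_ac)
    finally show ?thesis by (simp add: v_def lam_def j del: sum.lessThan_Suc)
  qed
  ultimately show ?case by blast
qed

text \<open>Matches the eigenvalues found by deflation with the sorted list behind
  \<open>eig\<close>: similarity to a diagonal matrix gives equal characteristic polynomials, hence
  equal multisets of roots, and the eigenvectors are permuted accordingly.\<close>

lemma spectral_decomposition:
  fixes A :: "real mat"
  assumes A: "A \<in> carrier_mat n n" and sym: "transpose_mat A = A"
  obtains v where "orthonormal {..<n} {..<n} v"
    "\<And>i k. i < n \<Longrightarrow> k < n \<Longrightarrow> A $$ (i, k) = (\<Sum>j<n. eig A (Suc j) * v j i * v j k)"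
proof -
  have "A $$ (i, k) = A $$ (k, i)" if "i < n" "k < n" for i k
    using transpose_eqD [OF A sym that] .
  then obtain v lam where v: "orthonormal {..<n} {..<n} v"
    "\<And>j i. j < n \<Longrightarrow> i < n \<Longrightarrow> (\<Sum>k<n. A $$ (i, k) * v j k) = lam j * v j i"
    using spectral_eigenvectors [of n "\<lambda>i k. A $$ (i, k)"] by blast
  note complete = orthonormal_complete [OF v(1)]
  have a: "A $$ (i, k) = (\<Sum>j<n. lam j * v j i * v j k)" if "i < n" "k < n" for i k
  proof -
    have "(\<Sum>j<n. lam j * v j i * v j k) = (\<Sum>j<n. (\<Sum>l<n. A $$ (i, l) * v j l) * v j k)"
      using v(2) that by (intro sum.cong refl) simp
    also have "\<dots> = (\<Sum>l<n. A $$ (i, l) * (\<Sum>j<n. v j l * v j k))"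
      unfolding sum_distrib_left sum_distrib_right by (subst sum.swap) (simp only: mult_ac)
    also have "\<dots> = (\<Sum>l<n. A $$ (i, l) * of_bool (l = k))"
      using orthonormalD [OF complete] that by (intro sum.cong refl) simp
    also have "\<dots> = A $$ (i, k)" using that by (intro sum_delta_of_bool) auto
    finally show ?thesis by simp
  qed
  define P where "P = mat n n (\<lambda>(i, j). v j i)"
  define D where "D = mat n n (\<lambda>(i, j). lam i * of_bool (i = j))"
  have c: "{A, D, P, transpose_mat P} \<subseteq> carrier_mat n n" using A by (auto simp: P_def D_def)
  have "similar_mat A D"
  proof (rule similar_matI [OF c])
    show "P * transpose_mat P = 1\<^sub>m n" using orthonormalD [OF complete]
      by (intro eq_matI) (auto simp: P_def scalar_prod_def atLeast0LessThan)
    show "transpose_mat P * P = 1\<^sub>m n" using orthonormalD [OF v(1)]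
      by (intro eq_matI) (auto simp: P_def scalar_prod_def atLeast0LessThan)
    have PD: "P * D = mat n n (\<lambda>(i, j). v j i * lam j)"
    proof (intro eq_matI)
      fix i j assume "i < dim_row (mat n n (\<lambda>(i, j). v j i * lam j))"
        "j < dim_col (mat n n (\<lambda>(i, j). v j i * lam j))"
      then have ij: "i < n" "j < n" by auto
      then have "(P * D) $$ (i, j) = (\<Sum>k<n. (v k i * lam k) * of_bool (k = j))"
        by (simp add: P_def D_def scalar_prod_def atLeast0LessThan mult.assoc)
      also have "\<dots> = v j i * lam j" using ij by (intro sum_delta_of_bool) auto
      finally show "(P * D) $$ (i, j) = mat n n (\<lambda>(i, j). v j i * lam j) $$ (i, j)"
        using ij by simp
    qed (auto simp: P_def D_def)
    show "A = P * D * transpose_mat P"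
      unfolding PD using A a
      by (intro eq_matI) (auto simp: P_def scalar_prod_def atLeast0LessThan mult_ac)
  qed
  then have "char_poly A = char_poly D" by (rule char_poly_similar)
  also have "\<dots> = (\<Prod>b\<leftarrow>diag_mat D. [:- b, 1:])"
    by (rule char_poly_upper_triangular [of _ n]) (auto simp: D_def)
  also have "diag_mat D = map lam [0..<n]" by (auto simp: diag_mat_def D_def)
  finally have cp: "char_poly A = (\<Prod>b\<leftarrow>map lam [0..<n]. [:- b, 1:])" .
  have "proots (\<Prod>b\<leftarrow>xs. [:- b, 1:]) = mset xs" for xs :: "real list"
  proof (induction xs)
    case (Cons x xs)
    have "(\<Prod>b\<leftarrow>xs. [:- b, 1:]) \<noteq> 0" by (auto simp: prod_list_zero_iff)
    then show ?case using Cons by (simp add: proots_mult del: mult_pCons_left)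
  qed simp
  then have "proots (char_poly A) = mset (map lam [0..<n])" unfolding cp .
  then have "mset (eigenvalues_desc A) = mset (map lam [0..<n])" by (simp add: eigenvalues_desc_def)
  then have "\<exists>f. bij_betw f {..<length (eigenvalues_desc A)} {..<length (map lam [0..<n])}
    \<and> (\<forall>i<length (eigenvalues_desc A). eigenvalues_desc A ! i = map lam [0..<n] ! f i)"
    by (rule permutation_Ex_bij)
  then obtain f where f: "bij_betw f {..<n} {..<n}"
    "\<And>j. j < n \<Longrightarrow> eigenvalues_desc A ! j = map lam [0..<n] ! f j"
    using length_eigenvalues_desc [OF A sym] by auto
  have fn: "f j < n" if "j < n" for j using f(1) that bij_betwE by blast
  have lam: "eig A (Suc j) = lam (f j)" if "j < n" for j using f(2) fn that by (simp add: eig_def)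
  show ?thesis
  proof
    show "orthonormal {..<n} {..<n} (\<lambda>j. v (f j))"
      using orthonormalD [OF v(1)] fn f(1) by (auto simp: orthonormal_def bij_betw_def inj_on_eq_iff)
    fix i k assume ik: "i < n" "k < n"
    have "(\<Sum>j<n. eig A (Suc j) * v (f j) i * v (f j) k) = (\<Sum>j<n. lam (f j) * v (f j) i * v (f j) k)"
      using lam by (intro sum.cong refl) simp
    also have "\<dots> = (\<Sum>j<n. lam j * v j i * v j k)"
      by (rule sum.reindex_bij_betw [OF f(1), of "\<lambda>j. lam j * v j i * v j k"])
    finally show "A $$ (i, k) = (\<Sum>j<n. eig A (Suc j) * v (f j) i * v (f j) k)" using a ik by simp
  qed
qed

text \<open>\<open>pick S\<close> numbers the elements of \<open>S\<close>; along this bijection the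
  eigenvectors of the submatrix become functions on \<open>S\<close>.\<close>

lemma principal_submatrix_spectral_decomposition:
  fixes A :: "real mat"
  assumes A: "A \<in> carrier_mat n n" and sym: "transpose_mat A = A" and S: "S \<subseteq> {..<n}"
  obtains u where "orthonormal {..<card S} S u" "orthonormal S {..<card S} (\<lambda>i q. u q i)"
    "\<And>i k. i \<in> S \<Longrightarrow> k \<in> S \<Longrightarrow>
      A $$ (i, k) = (\<Sum>q<card S. eig (principal_submatrix A S) (Suc q) * u q i * u q k)"
proof -
  define m where "m = card S"
  note B = principal_submatrix_symmetric [OF A sym S]
  obtain x where x: "orthonormal {..<m} {..<m} x"
    "\<And>i k. i < m \<Longrightarrow> k < m \<Longrightarrow> principal_submatrix A S $$ (i, k)
      = (\<Sum>j<m. eig (principal_submatrix A S) (Suc j) * x j i * x j k)"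
    using spectral_decomposition [OF B] unfolding m_def by blast
  have fS: "finite S" using S finite_subset by blast
  have inj: "inj_on (pick S) {..<m}"
    by (intro linorder_inj_onI) (auto simp: m_def dest: pick_mono_le)
  moreover have "pick S ` {..<m} \<subseteq> S" by (auto simp: m_def pick_in_set_le)
  ultimately have bij: "bij_betw (pick S) {..<m} S"
    using card_subset_eq [OF fS, of "pick S ` {..<m}"]
    by (simp add: bij_betw_def card_image m_def)
  define g where "g = the_inv_into {..<m} (pick S)"
  have g: "g (pick S a) = a" if "a < m" for a
    unfolding g_def using inj that by (intro the_inv_into_f_f) auto
  have gS: "g i < m" "pick S (g i) = i" if "i \<in> S" for i
    using bij_betw_imp_surj_on [OF bij] that g by (metis imageE lessThan_iff)+
  have "(\<Sum>i\<in>S. x q (g i) * x r (g i)) = (\<Sum>a<m. x q a * x r a)" for q r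
    using sum.reindex_bij_betw [OF bij, of "\<lambda>i. x q (g i) * x r (g i)"] g by simp
  then have 1: "orthonormal {..<m} S (\<lambda>q i. x q (g i))"
    using orthonormalD [OF x(1)] by (simp add: orthonormal_def)
  have 2: "orthonormal S {..<m} (\<lambda>i q. x q (g i))"
    unfolding orthonormal_def
  proof (intro ballI)
    fix i k assume ik: "i \<in> S" "k \<in> S"
    then have "g i = g k \<longleftrightarrow> i = k" using gS(2) by metis
    then show "(\<Sum>q<m. x q (g i) * x q (g k)) = of_bool (i = k)"
      using orthonormalD [OF orthonormal_complete [OF x(1)], of "g i" "g k"] gS(1) ik by simp
  qed
  have "A $$ (i, k) = (\<Sum>q<m. eig (principal_submatrix A S) (Suc q) * x q (g i) * x q (g k))"
    if "i \<in> S" "k \<in> S" for i k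
  proof -
    have "{i. i < n \<and> i \<in> S} = S" using S by auto
    then have "principal_submatrix A S $$ (g i, g k) = A $$ (i, k)"
      using submatrix_index [of "g i" A S "g k" S] gS that A by (auto simp: m_def)
    then show ?thesis using x(2) [of "g i" "g k"] gS that by simp
  qed
  with 1 2 show ?thesis using that unfolding m_def by blast
qed

subsection \<open>Eigenvalues of a sampled principal submatrix\<close>

text \<open>Both sides are the quadratic form of \<open>F\<^sup>T C F\<close>, with \<open>C\<close>
  the diagonal matrix of the weights. The weights are eigenvalues in some uses and centred
  indicators in others.\<close>

lemma weighted_sum_of_squares:
  fixes x :: "'i \<Rightarrow> real"
  shows "(\<Sum>j\<in>J. c j * (\<Sum>i\<in>I. f j i * x i)\<^sup>2)
    = (\<Sum>i\<in>I. \<Sum>k\<in>I. x i * x k * (\<Sum>j\<in>J. c j * f j i * f j k))"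
proof -
  have "(\<Sum>j\<in>J. c j * (\<Sum>i\<in>I. f j i * x i)\<^sup>2)
      = (\<Sum>j\<in>J. \<Sum>i\<in>I. \<Sum>k\<in>I. x i * x k * (c j * f j i * f j k))"
    by (intro sum.cong refl) (simp add: power2_eq_square sum_product sum_distrib_left mult_ac)
  also have "\<dots> = (\<Sum>i\<in>I. \<Sum>j\<in>J. \<Sum>k\<in>I. x i * x k * (c j * f j i * f j k))"
    by (rule sum.swap)
  also have "\<dots> = (\<Sum>i\<in>I. \<Sum>k\<in>I. \<Sum>j\<in>J. x i * x k * (c j * f j i * f j k))"
    by (intro sum.cong refl sum.swap)
  finally show ?thesis by (simp only: sum_distrib_left)
qed

text \<open>The hypothesis concerns the columns of \<open>f\<close>. So this covers both the norm of
  a combination of orthonormal vectors and the sum of squared coefficients in a complete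
  system.\<close>

lemma parseval:
  assumes "finite I" "orthonormal I J (\<lambda>i j. f j i)"
  shows "(\<Sum>j\<in>J. (\<Sum>i\<in>I. f j i * x i)\<^sup>2) = (\<Sum>i\<in>I. (x i)\<^sup>2)"
proof -
  have "(\<Sum>j\<in>J. 1 * (\<Sum>i\<in>I. f j i * x i)\<^sup>2)
      = (\<Sum>i\<in>I. \<Sum>k\<in>I. x i * x k * (\<Sum>j\<in>J. 1 * f j i * f j k))"
    by (rule weighted_sum_of_squares)
  also have "\<dots> = (\<Sum>i\<in>I. \<Sum>k\<in>I. x i * x k * of_bool (i = k))"
    using orthonormalD [OF assms(2)] by (intro sum.cong refl) simp
  also have "\<dots> = (\<Sum>i\<in>I. (x i)\<^sup>2)"
    using assms(1) by (intro sum.cong refl) (simp add: sum_delta_of_bool power2_eq_square)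
  finally show ?thesis by simp
qed

text \<open>Cauchy-Schwarz over \<open>J \<times> J\<close>: the Frobenius norm of
  \<open>z z\<^sup>T\<close> is the square norm of \<open>z\<close>.\<close>

lemma frobenius_bilinear:
  fixes z :: "'j \<Rightarrow> real"
  assumes "(\<Sum>j\<in>J. \<Sum>k\<in>J. (E j k)\<^sup>2) \<le> r\<^sup>2" "r \<ge> 0"
  shows "\<bar>\<Sum>j\<in>J. \<Sum>k\<in>J. z j * z k * E j k\<bar> \<le> r * (\<Sum>j\<in>J. (z j)\<^sup>2)"
proof -
  have "(\<Sum>j\<in>J. \<Sum>k\<in>J. z j * z k * E j k)\<^sup>2
      = (\<Sum>(j, k)\<in>J \<times> J. (z j * z k) * E j k)\<^sup>2"
    by (simp add: sum.cartesian_product)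
  also have "\<dots> = (\<Sum>y\<in>J \<times> J. (z (fst y) * z (snd y)) * E (fst y) (snd y))\<^sup>2"
    by (simp add: case_prod_beta)
  also have "\<dots> \<le> (\<Sum>y\<in>J \<times> J. (z (fst y) * z (snd y))\<^sup>2) * (\<Sum>y\<in>J \<times> J. (E (fst y) (snd y))\<^sup>2)"
    by (rule Cauchy_Schwarz_ineq_sum)
  also have "(\<Sum>y\<in>J \<times> J. (z (fst y) * z (snd y))\<^sup>2) = (\<Sum>j\<in>J. (z j)\<^sup>2)\<^sup>2"
    unfolding power_mult_distrib power2_eq_square [of "\<Sum>j\<in>J. (z j)\<^sup>2"] sum_product
      sum.cartesian_product by (intro sum.cong refl) auto
  also have "(\<Sum>y\<in>J \<times> J. (E (fst y) (snd y))\<^sup>2) = (\<Sum>j\<in>J. \<Sum>k\<in>J. (E j k)\<^sup>2)"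
    by (simp add: sum.cartesian_product case_prod_beta)
  also have "(\<Sum>j\<in>J. (z j)\<^sup>2)\<^sup>2 * \<dots> \<le> (\<Sum>j\<in>J. (z j)\<^sup>2)\<^sup>2 * r\<^sup>2"
    using assms(1) by (intro mult_left_mono) auto
  also have "\<dots> = (r * (\<Sum>j\<in>J. (z j)\<^sup>2))\<^sup>2" by (simp add: power_mult_distrib)
  finally have "\<bar>\<Sum>j\<in>J. \<Sum>k\<in>J. z j * z k * E j k\<bar> \<le> \<bar>r * (\<Sum>j\<in>J. (z j)\<^sup>2)\<bar>"
    by (simp only: abs_le_square_iff)
  moreover have "r * (\<Sum>j\<in>J. (z j)\<^sup>2) \<ge> 0" using assms(2) by (simp add: sum_nonneg)
  ultimately show ?thesis by linarith
qed

text \<open>In the basis \<open>v\<close> the matrix is diagonal with entries of modulus at most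
  \<open>\<theta>\<close>; Parseval is applied before and after the scaling.\<close>

lemma spectral_operator_bound:
  fixes v :: "nat \<Rightarrow> nat \<Rightarrow> real"
  assumes v: "orthonormal {..<n} {..<n} v" and J: "J \<subseteq> {..<n}"
    and lam: "\<And>j. j \<in> J \<Longrightarrow> \<bar>lam j\<bar> \<le> \<theta>"
  shows "(\<Sum>k<n. (\<Sum>i<n. (\<Sum>j\<in>J. lam j * v j k * v j i) * h i)\<^sup>2) \<le> \<theta>\<^sup>2 * (\<Sum>i<n. (h i)\<^sup>2)"
proof -
  have fJ: "finite J" using J finite_subset by blast
  define y where "y j = (\<Sum>i<n. v j i * h i)" for j
  have g: "(\<Sum>i<n. (\<Sum>j\<in>J. lam j * v j k * v j i) * h i) = (\<Sum>j\<in>J. v j k * (lam j * y j))" for k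
    unfolding y_def sum_distrib_left sum_distrib_right by (subst sum.swap) (simp only: mult_ac)
  have "orthonormal J {..<n} v" using v J by (rule orthonormal_subset)
  then have "(\<Sum>k<n. (\<Sum>j\<in>J. v j k * (lam j * y j))\<^sup>2) = (\<Sum>j\<in>J. (lam j * y j)\<^sup>2)"
    using fJ by (intro parseval) auto
  also have "\<dots> \<le> (\<Sum>j\<in>J. \<theta>\<^sup>2 * (y j)\<^sup>2)"
  proof (intro sum_mono)
    fix j assume "j \<in> J"
    then have "(lam j)\<^sup>2 \<le> \<theta>\<^sup>2" using lam [of j] abs_le_square_iff [of "lam j" \<theta>] by linarith
    then show "(lam j * y j)\<^sup>2 \<le> \<theta>\<^sup>2 * (y j)\<^sup>2" by (simp add: power_mult_distrib mult_right_mono)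
  qed
  also have "\<dots> \<le> (\<Sum>j<n. \<theta>\<^sup>2 * (y j)\<^sup>2)" using J by (intro sum_mono2) auto
  also have "\<dots> = \<theta>\<^sup>2 * (\<Sum>i<n. (h i)\<^sup>2)"
    unfolding sum_distrib_left [symmetric] y_def
    by (subst parseval) (auto intro: orthonormal_complete [OF v])
  finally show ?thesis unfolding g .
qed

text \<open>With \<open>D\<close> the diagonal 0-1 matrix of \<open>S\<close> and \<open>M\<close> the matrix with entries \<open>a\<close>, the operator
  norm of \<open>D M D\<close> is reduced to two Frobenius norms by
  \<open>(D M D)\<^sup>2 = p D M\<^sup>2 D + D M (D - p) M D\<close>, where the norm of \<open>D M\<^sup>2 D\<close> is that of
  \<open>M D M = p M\<^sup>2 + M (D - p) M\<close>.\<close>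

lemma sampled_form_bound:
  fixes v :: "nat \<Rightarrow> nat \<Rightarrow> real" and S :: "nat set" and p :: real
  defines "d \<equiv> \<lambda>i. of_bool (i \<in> S) - p"
  assumes v: "orthonormal {..<n} {..<n} v" and J: "J \<subseteq> {..<n}" and S: "S \<subseteq> {..<n}"
    and lam: "\<And>j. j \<in> J \<Longrightarrow> \<bar>lam j\<bar> \<le> \<theta>"
    and a: "\<And>i k. a i k = (\<Sum>j\<in>J. lam j * v j i * v j k)"
    and F1: "(\<Sum>j<n. \<Sum>k<n. (\<Sum>i<n. d i * a i j * a i k)\<^sup>2) \<le> r1\<^sup>2" "r1 \<ge> 0"
    and F2: "(\<Sum>j\<in>S. \<Sum>k\<in>S. (\<Sum>i<n. d i * a i j * a i k)\<^sup>2) \<le> r2\<^sup>2" "r2 \<ge> 0"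
    and p: "p \<ge> 0" and r: "p * (p * \<theta>\<^sup>2 + r1) + r2 \<le> r\<^sup>2" "r \<ge> 0"
  shows "\<bar>\<Sum>j\<in>J. lam j * (\<Sum>i\<in>S. v j i * x i)\<^sup>2\<bar> \<le> r * (\<Sum>i\<in>S. (x i)\<^sup>2)"
proof -
  have sym: "a i k = a k i" for i k unfolding a by (intro sum.cong refl) (simp only: mult_ac)
  \<comment> \<open>Sums over \<open>S\<close> are split according to
    \<open>D = p + (D - p)\<close>; the centred part is a quadratic form bounded by means of
    \<open>F1\<close> or \<open>F2\<close>.\<close>
  have split: "(\<Sum>i\<in>S. (f i)\<^sup>2) = p * (\<Sum>i<n. (f i)\<^sup>2) + (\<Sum>i<n. d i * (f i)\<^sup>2)" for f :: "nat \<Rightarrow> real"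
  proof -
    have "(\<Sum>i\<in>S. (f i)\<^sup>2) = (\<Sum>i<n. if i \<in> S then (f i)\<^sup>2 else 0)"
      using S by (simp add: sum.If_cases Int_absorb1)
    also have "\<dots> = (\<Sum>i<n. p * (f i)\<^sup>2 + d i * (f i)\<^sup>2)"
      by (intro sum.cong) (auto simp: d_def algebra_simps)
    finally show ?thesis by (simp add: sum.distrib sum_distrib_left)
  qed
  define N where "N = (\<Sum>i\<in>S. (x i)\<^sup>2)"
  \<comment> \<open>In matrix terms \<open>h = M D x\<close> and \<open>g = M h\<close>. Since
    \<open>M\<close> is symmetric, the square norm \<open>Z\<close> of \<open>h\<close> is the
    product of \<open>D x\<close> with \<open>g\<close>.\<close>
  define h where "h i = (\<Sum>k\<in>S. a i k * x k)" for i
  define Z where "Z = (\<Sum>i<n. (h i)\<^sup>2)"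
  define g where "g k = (\<Sum>i<n. a k i * h i)" for k
  have N: "N \<ge> 0" and Z: "Z \<ge> 0" by (auto simp: N_def Z_def intro: sum_nonneg)
  have "Z\<^sup>2 \<le> N * ((p * \<theta>\<^sup>2 + r1) * Z)"
  proof -
    have "Z = (\<Sum>k\<in>S. x k * g k)"
      unfolding Z_def g_def power2_eq_square h_def [of _] sum_distrib_left sum_distrib_right
      by (subst sum.swap) (simp only: mult_ac sym)
    then have "Z\<^sup>2 \<le> N * (\<Sum>k\<in>S. (g k)\<^sup>2)" unfolding N_def by (simp only: Cauchy_Schwarz_ineq_sum)
    moreover have "(\<Sum>k\<in>S. (g k)\<^sup>2) \<le> (p * \<theta>\<^sup>2 + r1) * Z"
    proof -
      have "(\<Sum>k<n. d k * (g k)\<^sup>2) = (\<Sum>i<n. \<Sum>l<n. h i * h l * (\<Sum>k<n. d k * a k i * a k l))"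
        unfolding g_def by (rule weighted_sum_of_squares)
      moreover have "\<dots> \<le> r1 * Z" unfolding Z_def using frobenius_bilinear [OF F1, of h] by linarith
      moreover have "(\<Sum>k<n. (g k)\<^sup>2) \<le> \<theta>\<^sup>2 * Z"
        unfolding g_def Z_def a using v J lam by (rule spectral_operator_bound)
      then have "p * (\<Sum>k<n. (g k)\<^sup>2) \<le> p * (\<theta>\<^sup>2 * Z)" using p by (rule mult_left_mono)
      ultimately show ?thesis unfolding split [of g] by (simp add: distrib_right mult.assoc)
    qed
    ultimately show ?thesis using N mult_left_mono order_trans by meson
  qed
  then have ZN: "Z \<le> N * (p * \<theta>\<^sup>2 + r1)"
  proof (cases "Z = 0")
    case True
    then show ?thesis using N p F1(2) by simp
  next
    case False
    assume "Z\<^sup>2 \<le> N * ((p * \<theta>\<^sup>2 + r1) * Z)"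
    then have "Z * Z \<le> (N * (p * \<theta>\<^sup>2 + r1)) * Z" by (simp only: power2_eq_square mult.assoc)
    then show ?thesis using False Z by simp
  qed
  define T where "T = (\<Sum>i\<in>S. x i * h i)"
  have "(\<Sum>i<n. d i * (h i)\<^sup>2) = (\<Sum>j\<in>S. \<Sum>k\<in>S. x j * x k * (\<Sum>i<n. d i * a i j * a i k))"
    unfolding h_def by (rule weighted_sum_of_squares)
  moreover have "\<dots> \<le> r2 * N" unfolding N_def using frobenius_bilinear [OF F2, of x] by linarith
  moreover have "p * Z \<le> p * (N * (p * \<theta>\<^sup>2 + r1))" using ZN p by (rule mult_left_mono)
  ultimately have hS: "(\<Sum>i\<in>S. (h i)\<^sup>2) \<le> (p * (p * \<theta>\<^sup>2 + r1) + r2) * N"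
    unfolding split [of h] Z_def [symmetric] by (simp add: algebra_simps)
  have "T\<^sup>2 \<le> N * (\<Sum>i\<in>S. (h i)\<^sup>2)" unfolding T_def N_def by (rule Cauchy_Schwarz_ineq_sum)
  also have "\<dots> \<le> N * ((p * (p * \<theta>\<^sup>2 + r1) + r2) * N)" using hS N by (rule mult_left_mono)
  also have "\<dots> = N\<^sup>2 * (p * (p * \<theta>\<^sup>2 + r1) + r2)" by (simp only: power2_eq_square mult_ac)
  also have "\<dots> \<le> N\<^sup>2 * r\<^sup>2" using r(1) by (intro mult_left_mono) auto
  finally have "T\<^sup>2 \<le> (r * N)\<^sup>2" by (simp add: power_mult_distrib mult.commute)
  then have "\<bar>T\<bar> \<le> \<bar>r * N\<bar>" by (simp only: abs_le_square_iff)
  then have "\<bar>T\<bar> \<le> r * N" using r(2) N by simp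
  moreover have "T = (\<Sum>j\<in>J. lam j * (\<Sum>i\<in>S. v j i * x i)\<^sup>2)"
    unfolding weighted_sum_of_squares T_def h_def a
    by (simp add: sum_distrib_left sum_distrib_right mult_ac)
  ultimately show ?thesis by (simp add: N_def)
qed

section \<open>Comparison of the two spectra for a fixed sample\<close>

text \<open>\<open>K\<close> indexes the outlying eigenvalues. For the matrix \<open>W\<close> with columns
  \<open>sqrt \<bar>lam j\<bar> * v j\<close>, \<open>j \<in> K\<close>, the assumption \<open>gram\<close> says that the sampled Gram matrix
  \<open>W\<^sup>T D W\<close> is within \<open>r\<close> of its expectation in Frobenius norm; \<open>rest\<close> bounds the sampled matrix
  of the remaining eigenvalues.\<close>

locale sampled_spectrum =
  fixes n m :: nat and S K :: "nat set" and v u :: "nat \<Rightarrow> nat \<Rightarrow> real"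
    and lam mu :: "nat \<Rightarrow> real" and p r :: real
  assumes finS: "finite S" and K: "K \<subseteq> {..<n}"
    and u: "orthonormal {..<m} S u" and u_complete: "orthonormal S {..<m} (\<lambda>i q. u q i)"
    and spectra: "\<And>i k. i \<in> S \<Longrightarrow> k \<in> S \<Longrightarrow>
      (\<Sum>q<m. mu q * u q i * u q k) = (\<Sum>j<n. lam j * v j i * v j k)"
    and gram: "(\<Sum>j\<in>K. \<Sum>k\<in>K. ((\<Sum>i\<in>S. (sqrt \<bar>lam j\<bar> * v j i) * (sqrt \<bar>lam k\<bar> * v k i))
      - p * \<bar>lam j\<bar> * of_bool (j = k))\<^sup>2) \<le> r\<^sup>2"
    and rest: "\<And>x. \<bar>\<Sum>j\<in>{..<n} - K. lam j * (\<Sum>i\<in>S. v j i * x i)\<^sup>2\<bar> \<le> r * (\<Sum>i\<in>S. (x i)\<^sup>2)"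
    and p: "p \<ge> 0" and r: "r > 0"
begin

text \<open>\<open>gram\<close> sees only \<open>\<bar>lam j\<bar>\<close>, while in
  \<open>spectra\<close> and \<open>rest\<close> the sign factors out. Bounds for the top of the
  spectrum thereby also serve for the bottom.\<close>

lemma sampled_spectrum_uminus: "sampled_spectrum n m S K v u (\<lambda>j. - lam j) (\<lambda>q. - mu q) p r"
  using finS K u u_complete spectra gram rest p r
  by unfold_locales (simp_all add: sum_negf)

definition w where "w j i = sqrt \<bar>lam j\<bar> * v j i"

definition ip where "ip x y = (\<Sum>i\<in>S. x i * y i :: real)"

definition E where "E j k = ip (w j) (w k) - p * \<bar>lam j\<bar> * of_bool (j = k)"

lemma finK: "finite K"
  using K finite_subset by blast

lemma ip_commute: "ip x y = ip y x"
  by (simp add: ip_def mult.commute)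

lemma ip_sum_right: "ip x (\<lambda>i. \<Sum>j\<in>J. y j * f j i) = (\<Sum>j\<in>J. y j * ip x (f j))"
  unfolding ip_def sum_distrib_left by (subst sum.swap) (simp only: mult_ac)

lemma ip_self: "ip x x = (\<Sum>i\<in>S. (x i)\<^sup>2)"
  by (simp add: ip_def power2_eq_square)

lemma ip_Cauchy_Schwarz: "(ip x y)\<^sup>2 \<le> ip x x * ip y y"
  unfolding ip_self unfolding ip_def by (rule Cauchy_Schwarz_ineq_sum)

lemma ip_parseval: "(\<Sum>q<m. (ip (u q) x)\<^sup>2) = ip x x"
  unfolding ip_self unfolding ip_def using finS u_complete by (rule parseval)

lemma gram_E: "(\<Sum>j\<in>K. \<Sum>k\<in>K. (E j k)\<^sup>2) \<le> r\<^sup>2"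
  using gram by (simp add: E_def ip_def w_def)

lemma gram_E_subset:
  assumes "L \<subseteq> K" "M \<subseteq> K"
  shows "(\<Sum>j\<in>L. \<Sum>k\<in>M. (E j k)\<^sup>2) \<le> r\<^sup>2"
proof -
  have "(\<Sum>j\<in>L. \<Sum>k\<in>M. (E j k)\<^sup>2) \<le> (\<Sum>j\<in>L. \<Sum>k\<in>K. (E j k)\<^sup>2)"
    using assms finK by (intro sum_mono sum_mono2) auto
  also have "\<dots> \<le> (\<Sum>j\<in>K. \<Sum>k\<in>K. (E j k)\<^sup>2)"
    using assms finK by (intro sum_mono2) (auto intro: sum_nonneg)
  finally show ?thesis using gram_E by linarith
qed

text \<open>The form of the sampled matrix at \<open>x\<close>, in its own eigenbasis and in that of
  the full matrix; the outlying part appears as \<open>W J W\<^sup>T\<close> with \<open>sgn\<close>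
  as \<open>J\<close>.\<close>

lemma quadratic_form:
  "(\<Sum>q<m. mu q * (ip (u q) x)\<^sup>2) = (\<Sum>j\<in>K. sgn (lam j) * (ip (w j) x)\<^sup>2)
     + (\<Sum>j\<in>{..<n} - K. lam j * (ip (v j) x)\<^sup>2)"
proof -
  have "(\<Sum>q<m. mu q * (ip (u q) x)\<^sup>2) = (\<Sum>j<n. lam j * (ip (v j) x)\<^sup>2)"
    unfolding ip_def weighted_sum_of_squares using spectra by (intro sum.cong refl) simp
  also have "\<dots> = (\<Sum>j\<in>K. lam j * (ip (v j) x)\<^sup>2) + (\<Sum>j\<in>{..<n} - K. lam j * (ip (v j) x)\<^sup>2)"
    using K by (subst sum.subset_diff [of K]) auto
  also have "(\<Sum>j\<in>K. lam j * (ip (v j) x)\<^sup>2) = (\<Sum>j\<in>K. sgn (lam j) * (ip (w j) x)\<^sup>2)"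
  proof (intro sum.cong refl)
    fix j
    have "ip (w j) x = sqrt \<bar>lam j\<bar> * ip (v j) x"
      by (simp add: ip_def w_def sum_distrib_left mult.assoc)
    then have "sgn (lam j) * (ip (w j) x)\<^sup>2 = (sgn (lam j) * \<bar>lam j\<bar>) * (ip (v j) x)\<^sup>2"
      by (simp add: power_mult_distrib)
    then show "lam j * (ip (v j) x)\<^sup>2 = sgn (lam j) * (ip (w j) x)\<^sup>2"
      by (simp add: sgn_mult_abs)
  qed
  finally show ?thesis .
qed

lemma rest_ip: "\<bar>\<Sum>j\<in>{..<n} - K. lam j * (ip (v j) x)\<^sup>2\<bar> \<le> r * ip x x"
  unfolding ip_self unfolding ip_def by (rule rest)

text \<open>\<open>ip y y\<close> is the form of the sampled Gram matrix at \<open>z\<close>. That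
  matrix is \<open>p \<bar>\<Lambda>\<bar> + E\<close>, and the Frobenius norm of \<open>E\<close>
  bounds its form.\<close>

lemma combination_norm:
  fixes z :: "nat \<Rightarrow> real"
  assumes L: "L \<subseteq> K"
  defines "y \<equiv> (\<lambda>i. \<Sum>j\<in>L. z j * w j i)"
  shows "\<bar>ip y y - p * (\<Sum>j\<in>L. \<bar>lam j\<bar> * (z j)\<^sup>2)\<bar> \<le> r * (\<Sum>j\<in>L. (z j)\<^sup>2)"
proof -
  have fL: "finite L" using L finK finite_subset by blast
  have "ip y y = (\<Sum>j\<in>L. z j * ip y (w j))" by (subst (2) y_def) (rule ip_sum_right)
  also have "\<dots> = (\<Sum>j\<in>L. z j * ip (w j) y)" by (simp only: ip_commute)
  also have "\<dots> = (\<Sum>j\<in>L. z j * (\<Sum>k\<in>L. z k * ip (w j) (w k)))"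
    unfolding y_def ip_sum_right ..
  also have "\<dots> = (\<Sum>j\<in>L. (\<Sum>k\<in>L. z j * z k * E j k) + (\<Sum>k\<in>L. (p * \<bar>lam j\<bar> * z j * z k) * of_bool (j = k)))"
    unfolding sum_distrib_left sum.distrib [symmetric]
    by (intro sum.cong refl) (simp add: E_def algebra_simps)
  also have "\<dots> = (\<Sum>j\<in>L. (\<Sum>k\<in>L. z j * z k * E j k) + p * (\<bar>lam j\<bar> * (z j)\<^sup>2))"
    using fL by (intro sum.cong refl) (simp add: sum_delta_of_bool power2_eq_square)
  finally have "ip y y - p * (\<Sum>j\<in>L. \<bar>lam j\<bar> * (z j)\<^sup>2) = (\<Sum>j\<in>L. \<Sum>k\<in>L. z j * z k * E j k)"
    by (simp add: sum.distrib sum_distrib_left)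
  then show ?thesis using frobenius_bilinear [OF gram_E_subset [OF L L]] r by simp
qed

text \<open>\<open>W\<close> and its transpose have the same norm. For
  \<open>y = W W\<^sup>T x\<close>, restricted to \<open>L\<close>, one has
  \<open>ip x y = Z\<close>; Cauchy-Schwarz and \<open>combination_norm\<close> bound
  \<open>Z\<^sup>2\<close> by a multiple of \<open>Z\<close>, and \<open>Z\<close> is
  cancelled.\<close>

lemma outlying_bound:
  assumes L: "L \<subseteq> K" and t: "\<And>j. j \<in> L \<Longrightarrow> \<bar>lam j\<bar> \<le> t" "t \<ge> 0"
  shows "(\<Sum>j\<in>L. (ip (w j) x)\<^sup>2) \<le> (p * t + r) * ip x x"
proof -
  define Z where "Z = (\<Sum>j\<in>L. (ip (w j) x)\<^sup>2)"
  define y where "y = (\<lambda>i. \<Sum>j\<in>L. ip (w j) x * w j i)"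
  have Z: "Z \<ge> 0" by (simp add: Z_def sum_nonneg)
  have N: "ip x x \<ge> 0" by (simp add: ip_self sum_nonneg)
  have "ip x y = Z"
    unfolding y_def ip_sum_right Z_def power2_eq_square by (simp add: ip_commute)
  then have "Z\<^sup>2 \<le> ip x x * ip y y" using ip_Cauchy_Schwarz [of x y] by simp
  also have "ip y y \<le> (p * t + r) * Z"
  proof -
    have "(\<Sum>j\<in>L. \<bar>lam j\<bar> * (ip (w j) x)\<^sup>2) \<le> t * Z"
      unfolding Z_def sum_distrib_left using t by (intro sum_mono mult_right_mono) auto
    then have "p * (\<Sum>j\<in>L. \<bar>lam j\<bar> * (ip (w j) x)\<^sup>2) \<le> p * (t * Z)"
      using p by (rule mult_left_mono)
    moreover have "ip y y - p * (\<Sum>j\<in>L. \<bar>lam j\<bar> * (ip (w j) x)\<^sup>2) \<le> r * Z"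
      using combination_norm [OF L, of "\<lambda>j. ip (w j) x"] unfolding y_def Z_def by linarith
    ultimately show ?thesis by (simp add: algebra_simps)
  qed
  finally have *: "Z\<^sup>2 \<le> ip x x * ((p * t + r) * Z)" using N by (simp add: mult_left_mono)
  show ?thesis
  proof (cases "Z = 0")
    case True
    then show ?thesis using N p r t(2) by (simp add: Z_def)
  next
    case False
    then have "Z > 0" using Z by simp
    moreover have "Z * Z \<le> ((p * t + r) * ip x x) * Z"
      using * by (simp add: power2_eq_square mult_ac)
    ultimately show ?thesis using mult_right_le_imp_le unfolding Z_def by blast
  qed
qed

text \<open>Courant--Fischer without an ordering of the eigenvalues: the test vector lies in the span of
  the \<open>u q\<close>, \<open>q \<in> Q\<close>, and is orthogonal to the \<open>v j\<close>, \<open>j \<in> R\<close>.\<close>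

lemma sampled_eigenvalue_upper:
  assumes R: "R \<subseteq> {..<n}" and t: "\<And>j. j \<in> {..<n} - R \<Longrightarrow> lam j \<le> t" "t \<ge> 0"
    and Q: "Q \<subseteq> {..<m}" "card R < card Q" and b: "\<And>q. q \<in> Q \<Longrightarrow> b \<le> mu q"
  shows "b \<le> p * t + 2 * r"
proof -
  have fin: "finite R" "finite Q" using R Q(1) finite_subset by blast+
  obtain y where y: "\<exists>q\<in>Q. y q \<noteq> 0" "\<And>j. j \<in> R \<Longrightarrow> (\<Sum>q\<in>Q. ip (v j) (u q) * y q) = 0"
    using homogeneous_system_nontrivial [OF fin Q(2), of "\<lambda>j q. ip (v j) (u q)"] by blast
  define x where "x = (\<lambda>i. \<Sum>q\<in>Q. y q * u q i)"
  define N where "N = (\<Sum>q\<in>Q. (y q)\<^sup>2)"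
  have vx: "ip (v j) x = 0" if "j \<in> R" for j
    using y(2) [OF that] unfolding x_def ip_sum_right by (simp add: mult.commute)
  have ux: "ip (u q) x = (if q \<in> Q then y q else 0)" if "q < m" for q
  proof -
    have "ip (u q) x = (\<Sum>k\<in>Q. y k * of_bool (q = k))"
      unfolding x_def ip_sum_right using orthonormalD [OF u] that Q(1)
      by (intro sum.cong refl) (auto simp: ip_def)
    also have "\<dots> = (if q \<in> Q then y q else 0)"
      using fin(2) by (auto simp: sum_delta_of_bool intro: sum.neutral)
    finally show ?thesis .
  qed
  have sumQ: "(\<Sum>q<m. f q * (ip (u q) x)\<^sup>2) = (\<Sum>q\<in>Q. f q * (y q)\<^sup>2)" for f
  proof -
    have "(\<Sum>q<m. f q * (ip (u q) x)\<^sup>2) = (\<Sum>q<m. if q \<in> Q then f q * (y q)\<^sup>2 else 0)"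
      by (intro sum.cong refl) (simp add: ux)
    then show ?thesis using Q(1) by (simp add: sum.If_cases Int_absorb1)
  qed
  have xx: "ip x x = N"
    using ip_parseval [of x] sumQ [of "\<lambda>_. 1"] by (simp add: N_def)
  obtain q where "q \<in> Q" "y q \<noteq> 0" using y(1) by blast
  then have N: "N > 0" unfolding N_def using fin by (intro sum_pos2 [of _ q]) auto
  \<comment> \<open>Within \<open>K\<close>, the indices in \<open>R\<close> contribute 0 and
    nonpositive eigenvalues only lower the form. On \<open>L\<close> the bound \<open>t\<close>
    holds for the modulus as well.\<close>
  define L where "L = {j \<in> K - R. lam j > 0}"
  have "b * N \<le> (\<Sum>q<m. mu q * (ip (u q) x)\<^sup>2)"
    unfolding sumQ N_def sum_distrib_left using b by (intro sum_mono mult_right_mono) auto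
  also have "\<dots> = (\<Sum>j\<in>K. sgn (lam j) * (ip (w j) x)\<^sup>2)
     + (\<Sum>j\<in>{..<n} - K. lam j * (ip (v j) x)\<^sup>2)" by (rule quadratic_form)
  also have "(\<Sum>j\<in>{..<n} - K. lam j * (ip (v j) x)\<^sup>2) \<le> r * N"
    using rest_ip [of x] unfolding xx by linarith
  also have "(\<Sum>j\<in>K. sgn (lam j) * (ip (w j) x)\<^sup>2) \<le> (\<Sum>j\<in>K. if j \<in> L then (ip (w j) x)\<^sup>2 else 0)"
  proof (intro sum_mono)
    fix j assume "j \<in> K"
    moreover have "ip (w j) x = 0" if "j \<in> R"
    proof -
      have "ip (w j) x = sqrt \<bar>lam j\<bar> * ip (v j) x"
        by (simp add: ip_def w_def sum_distrib_left mult.assoc)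
      then show ?thesis using vx [OF that] by simp
    qed
    ultimately show "sgn (lam j) * (ip (w j) x)\<^sup>2 \<le> (if j \<in> L then (ip (w j) x)\<^sup>2 else 0)"
      by (auto simp: L_def sgn_if)
  qed
  also have "\<dots> = (\<Sum>j\<in>L. (ip (w j) x)\<^sup>2)"
  proof -
    have "K \<inter> L = L" by (auto simp: L_def)
    then show ?thesis using finK by (simp add: sum.If_cases)
  qed
  also have "\<dots> \<le> (p * t + r) * ip x x"
  proof (rule outlying_bound)
    show "L \<subseteq> K" by (auto simp: L_def)
    show "\<bar>lam j\<bar> \<le> t" if "j \<in> L" for j using that t(1) K by (auto simp: L_def)
  qed (rule t)
  \<comment> \<open>One \<open>r\<close> is due to \<open>rest\<close>, the other to the Gram error
    in \<open>outlying_bound\<close>.\<close>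
  finally have "b * N \<le> (p * t + 2 * r) * N" unfolding xx by (simp add: algebra_simps)
  then show ?thesis using N by simp
qed

text \<open>Here the test vector is \<open>x = D W y\<close> with \<open>y\<close> supported on \<open>R\<close>. If \<open>G\<close> is the sampled Gram
  matrix on \<open>R\<close>, then \<open>x \<bullet> x = y \<bullet> G y\<close>, whereas the outlying eigenvalues in \<open>R\<close> contribute
  \<open>\<bar>G y\<bar>\<^sup>2 \<ge> g (y \<bullet> G y)\<close> to the form, since \<open>G \<ge> g = p t - r\<close>.\<close>

lemma sampled_eigenvalue_lower:
  assumes R: "R \<subseteq> K" and t: "\<And>j. j \<in> R \<Longrightarrow> t \<le> lam j" "3 * r \<le> p * t"
    and Q: "Q \<subseteq> {..<m}" "card Q < card R"
  shows "\<exists>q\<in>{..<m} - Q. p * t - 3 * r \<le> mu q"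
proof (rule ccontr)
  assume "\<not> ?thesis"
  then have mu: "mu q \<le> p * t - 3 * r" if "q \<in> {..<m} - Q" for q using that by force
  have fin: "finite R" "finite Q" using R Q(1) finK finite_subset by blast+
  have tpos: "t > 0" using t(2) p r by (metis linorder_not_less mult_nonneg_nonpos
    mult_pos_pos not_le order_trans zero_less_numeral)
  \<comment> \<open>This makes \<open>x\<close> orthogonal to the \<open>u q\<close> with
    \<open>q \<in> Q\<close>, so the form at \<open>x\<close> sees only the eigenvalues bounded in
    \<open>mu\<close>.\<close>
  obtain y where y: "\<exists>j\<in>R. y j \<noteq> 0" "\<And>q. q \<in> Q \<Longrightarrow> (\<Sum>j\<in>R. ip (u q) (w j) * y j) = 0"
    using homogeneous_system_nontrivial [OF fin(2,1) Q(2), of "\<lambda>q j. ip (u q) (w j)"] by blast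
  define x where "x = (\<lambda>i. \<Sum>j\<in>R. y j * w j i)"
  define Y where "Y = (\<Sum>j\<in>R. (y j)\<^sup>2)"
  define N where "N = ip x x"
  define g where "g = p * t - r"
  define P where "P = (\<Sum>j\<in>R. (ip (w j) x)\<^sup>2)"
  define M where "M = (\<Sum>j\<in>K - R. (ip (w j) x)\<^sup>2)"
  have g: "g \<ge> 2 * r" "g > 0" using t(2) r by (auto simp: g_def)
  obtain j where "j \<in> R" "y j \<noteq> 0" using y(1) by blast
  then have Y: "Y > 0" unfolding Y_def using fin by (intro sum_pos2 [of _ j]) auto
  have ux: "ip (u q) x = 0" if "q \<in> Q" for q
    using y(2) [OF that] unfolding x_def ip_sum_right by (simp add: mult.commute)
  have "t * Y \<le> (\<Sum>j\<in>R. \<bar>lam j\<bar> * (y j)\<^sup>2)"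
    unfolding Y_def sum_distrib_left using t(1) by (intro sum_mono mult_right_mono) force+
  then have "p * (t * Y) \<le> p * (\<Sum>j\<in>R. \<bar>lam j\<bar> * (y j)\<^sup>2)" using p by (rule mult_left_mono)
  moreover have "p * (\<Sum>j\<in>R. \<bar>lam j\<bar> * (y j)\<^sup>2) - r * Y \<le> N"
    using combination_norm [OF R, of y] unfolding x_def N_def Y_def by linarith
  ultimately have gN: "g * Y \<le> N" by (simp add: g_def algebra_simps)
  then have N: "N > 0" using mult_pos_pos [OF g(2) Y] by linarith
  have "N = (\<Sum>j\<in>R. y j * ip (w j) x)"
    unfolding N_def by (subst (2) x_def) (simp only: ip_sum_right ip_commute)
  then have "N\<^sup>2 \<le> Y * P" unfolding Y_def P_def by (simp only: Cauchy_Schwarz_ineq_sum)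
  moreover have "g * Y * N \<le> N\<^sup>2" using gN N by (simp add: power2_eq_square)
  ultimately have "Y * (g * N) \<le> Y * P" by (simp add: mult_ac)
  then have P: "g * N \<le> P" using Y by simp
  \<comment> \<open>For \<open>j\<close> outside \<open>R\<close> the diagonal term of
    \<open>E\<close> is absent: these outlying directions enter only through the Gram error.\<close>
  have "M \<le> (\<Sum>j\<in>K - R. (\<Sum>k\<in>R. (E j k)\<^sup>2) * Y)"
    unfolding M_def
  proof (intro sum_mono)
    fix j assume j: "j \<in> K - R"
    have "ip (w j) x = (\<Sum>k\<in>R. E j k * y k)"
      unfolding x_def ip_sum_right using j by (intro sum.cong refl) (auto simp: E_def)
    then show "(ip (w j) x)\<^sup>2 \<le> (\<Sum>k\<in>R. (E j k)\<^sup>2) * Y"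
      unfolding Y_def by (simp only: Cauchy_Schwarz_ineq_sum)
  qed
  also have "\<dots> \<le> r\<^sup>2 * Y"
    unfolding sum_distrib_right [symmetric] using gram_E_subset [of "K - R" R] R Y
    by (intro mult_right_mono) auto
  \<comment> \<open>The factor 2 allows \<open>g \<ge> 2 * r\<close> to replace one
    \<open>r\<close>, after which \<open>g * Y \<le> N\<close> applies.\<close>
  finally have "2 * M \<le> r * (2 * r * Y)" by (simp add: power2_eq_square)
  also have "\<dots> \<le> r * (g * Y)" using g r Y by (intro mult_left_mono mult_right_mono) auto
  also have "\<dots> \<le> r * N" using gN r by (intro mult_left_mono) auto
  finally have M: "2 * M \<le> r * N" .
  have "(\<Sum>j\<in>K. sgn (lam j) * (ip (w j) x)\<^sup>2) + (\<Sum>j\<in>{..<n} - K. lam j * (ip (v j) x)\<^sup>2)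
      = (\<Sum>q<m. mu q * (ip (u q) x)\<^sup>2)" by (rule quadratic_form [symmetric])
  also have "\<dots> \<le> (\<Sum>q<m. (p * t - 3 * r) * (ip (u q) x)\<^sup>2)"
  proof (intro sum_mono)
    fix q assume "q \<in> {..<m}"
    then show "mu q * (ip (u q) x)\<^sup>2 \<le> (p * t - 3 * r) * (ip (u q) x)\<^sup>2"
      using mu ux by (cases "q \<in> Q") (auto intro: mult_right_mono)
  qed
  also have "\<dots> = (p * t - 3 * r) * N"
    unfolding sum_distrib_left [symmetric] ip_parseval N_def ..
  finally have 1: "(\<Sum>j\<in>K. sgn (lam j) * (ip (w j) x)\<^sup>2) - r * N \<le> (p * t - 3 * r) * N"
    using rest_ip [of x] unfolding N_def by linarith
  have "(\<Sum>j\<in>K. sgn (lam j) * (ip (w j) x)\<^sup>2)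
      = (\<Sum>j\<in>K - R. sgn (lam j) * (ip (w j) x)\<^sup>2) + (\<Sum>j\<in>R. sgn (lam j) * (ip (w j) x)\<^sup>2)"
    using R finK by (intro sum.subset_diff) auto
  moreover have "(\<Sum>j\<in>R. sgn (lam j) * (ip (w j) x)\<^sup>2) = P"
    unfolding P_def using t(1) tpos by (intro sum.cong refl) force
  moreover have "- M \<le> (\<Sum>j\<in>K - R. sgn (lam j) * (ip (w j) x)\<^sup>2)"
    unfolding M_def sum_negf [symmetric] by (intro sum_mono) (auto simp: sgn_if)
  ultimately have "P - M - r * N \<le> (p * t - 3 * r) * N" using 1 by linarith
  \<comment> \<open>The form at \<open>x\<close> is at least
    \<open>(g - r / 2 - r) * N = (p * t - 5 / 2 * r) * N\<close>, which exceeds the upper bound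
    \<open>(p * t - 3 * r) * N\<close>.\<close>
  then have "2 * (g * N) - r * N - 2 * (r * N) \<le> 2 * ((p * t - 3 * r) * N)"
    using P M by linarith
  then have "r * N \<le> 0" by (simp add: g_def algebra_simps)
  then show False using mult_pos_pos [OF r N] by linarith
qed

end

subsection \<open>Second moments of a Bernoulli sample\<close>

locale bernoulli_sample =
  fixes n :: nat and p :: real
  assumes p_range: "0 \<le> p" "p \<le> 1"
begin

abbreviation "M \<equiv> random_subset n p"

text \<open>The diagonal of \<open>D - p\<close>, whose entries have mean 0.\<close>

definition d :: "nat set \<Rightarrow> nat \<Rightarrow> real" where "d S i = of_bool (i \<in> S) - p"

lemma set_pmf_sample: "set_pmf M \<subseteq> Pow {..<n}"
  by (auto simp: random_subset_def)

lemma integrable_sample: "integrable M (f :: nat set \<Rightarrow> real)"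
  using set_pmf_sample by (intro integrable_measure_pmf_finite) (auto intro: finite_subset)

lemma expectation_mono:
  fixes f g :: "nat set \<Rightarrow> real"
  assumes "\<And>S. S \<subseteq> {..<n} \<Longrightarrow> f S \<le> g S"
  shows "measure_pmf.expectation M f \<le> measure_pmf.expectation M g"
  using set_pmf_sample assms
  by (intro integral_mono_AE integrable_sample) (auto simp: AE_measure_pmf_iff)

text \<open>The indicator is a product of functions of the independent coordinates, so the
  expectation factorises.\<close>

lemma expectation_superset:
  assumes "T \<subseteq> {..<n}"
  shows "measure_pmf.expectation M (\<lambda>S. of_bool (T \<subseteq> S)) = p ^ card T"
proof -
  have "of_bool (T \<subseteq> {i \<in> {..<n}. b i}) = (\<Prod>i<n. if i \<in> T then of_bool (b i) else 1 :: real)" for b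
  proof (cases "T \<subseteq> {i \<in> {..<n}. b i}")
    case True
    then have "(\<Prod>i<n. if i \<in> T then of_bool (b i) else 1 :: real) = 1"
      by (intro prod.neutral) auto
    with True show ?thesis by simp
  next
    case False
    then obtain i where "i \<in> T" "i < n" "\<not> b i" using assms by auto
    then have "\<exists>i\<in>{..<n}. (if i \<in> T then of_bool (b i) else 1 :: real) = 0" by auto
    with False show ?thesis by (simp add: prod_zero)
  qed
  then have "measure_pmf.expectation M (\<lambda>S. of_bool (T \<subseteq> S) :: real)
     = measure_pmf.expectation (Pi_pmf {..<n} False (\<lambda>_. bernoulli_pmf p))
        (\<lambda>b. \<Prod>i<n. if i \<in> T then of_bool (b i) else 1)"
    by (simp only: random_subset_def integral_map_pmf)
  also have "\<dots> = (\<Prod>i<n. measure_pmf.expectation (bernoulli_pmf p)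
      (\<lambda>x. if i \<in> T then of_bool x else 1))"
    by (rule expectation_prod_Pi_pmf) (auto intro: integrable_measure_pmf_finite)
  also have "\<dots> = (\<Prod>i<n. if i \<in> T then p else 1)"
    using p_range by (intro prod.cong refl) auto
  also have "\<dots> = p ^ card T"
    using assms by (simp add: prod.If_cases Int_absorb1)
  finally show ?thesis .
qed

text \<open>The event \<open>J \<subseteq> S\<close> is independent of the \<open>d S i\<close> with
  \<open>i\<close> outside \<open>J\<close>, which are independent and centred with variance
  \<open>p * (1 - p)\<close>.\<close>

lemma expectation_covariance:
  assumes J: "J \<subseteq> {..<n}" and il: "i \<in> {..<n} - J" "l \<in> {..<n} - J"
  shows "measure_pmf.expectation M (\<lambda>S. of_bool (J \<subseteq> S) * (d S i * d S l))
    = p ^ card J * (p * (1 - p)) * of_bool (i = l)"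
proof -
  note [simp] = integrable_sample
  have fJ: "finite J" using J finite_subset by blast
  \<comment> \<open>A product of membership indicators is the indicator for the union, so
    \<open>expectation_superset\<close> evaluates every term.\<close>
  have "of_bool (J \<subseteq> S) * (d S i * d S l) = of_bool (insert i (insert l J) \<subseteq> S)
      - p * of_bool (insert i J \<subseteq> S) - p * of_bool (insert l J \<subseteq> S) + p * p * of_bool (J \<subseteq> S)" for S
    by (auto simp: d_def algebra_simps)
  moreover have "measure_pmf.expectation M (\<lambda>S. of_bool (T \<subseteq> S)) = p ^ card T"
    if "T \<in> {J, insert i J, insert l J, insert i (insert l J)}" for T
    using J il that by (intro expectation_superset) auto
  ultimately have "measure_pmf.expectation M (\<lambda>S. of_bool (J \<subseteq> S) * (d S i * d S l))
     = p ^ card (insert i (insert l J)) - p * p ^ card (insert i J) - p * p ^ card (insert l J) + p * p * p ^ card J"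
    by (simp del: insert_subset)
  also have "\<dots> = p ^ card J * (p * (1 - p)) * of_bool (i = l)"
    using il fJ by (cases "i = l") (auto simp: algebra_simps)
  finally show ?thesis .
qed

text \<open>The mixed terms vanish in expectation. \<open>J = {}\<close> gives the plain second
  moment, \<open>J = {j, k}\<close> the one restricted to a sampled entry.\<close>

lemma expectation_square:
  assumes J: "J \<subseteq> {..<n}" and I: "I \<subseteq> {..<n} - J"
  shows "measure_pmf.expectation M (\<lambda>S. of_bool (J \<subseteq> S) * (\<Sum>i\<in>I. d S i * c i)\<^sup>2)
    \<le> p ^ card J * (p * (\<Sum>i\<in>I. (c i)\<^sup>2))"
proof -
  note [simp] = integrable_sample
  have fI: "finite I" using I finite_subset by blast
  have "of_bool (J \<subseteq> S) * (\<Sum>i\<in>I. d S i * c i)\<^sup>2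
      = (\<Sum>i\<in>I. \<Sum>l\<in>I. c i * c l * (of_bool (J \<subseteq> S) * (d S i * d S l)))" for S
    by (simp add: power2_eq_square sum_product sum_distrib_left mult_ac)
  then have "measure_pmf.expectation M (\<lambda>S. of_bool (J \<subseteq> S) * (\<Sum>i\<in>I. d S i * c i)\<^sup>2)
      = (\<Sum>i\<in>I. \<Sum>l\<in>I. c i * c l * measure_pmf.expectation M (\<lambda>S. of_bool (J \<subseteq> S) * (d S i * d S l)))"
    by simp
  also have "\<dots> = (\<Sum>i\<in>I. \<Sum>l\<in>I. (p ^ card J * (p * (1 - p)) * c i * c l) * of_bool (i = l))"
  proof (intro sum.cong refl)
    fix i l assume "i \<in> I" "l \<in> I"
    then have "i \<in> {..<n} - J" "l \<in> {..<n} - J" using I by auto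
    from expectation_covariance [OF J this]
    show "c i * c l * measure_pmf.expectation M (\<lambda>S. of_bool (J \<subseteq> S) * (d S i * d S l))
      = (p ^ card J * (p * (1 - p)) * c i * c l) * of_bool (i = l)" by (simp only: mult_ac)
  qed
  also have "\<dots> = (\<Sum>i\<in>I. p ^ card J * (p * (1 - p)) * (c i)\<^sup>2)"
    using fI by (intro sum.cong refl) (simp add: sum_delta_of_bool power2_eq_square)
  also have "\<dots> \<le> (\<Sum>i\<in>I. p ^ card J * p * (c i)\<^sup>2)"
    using p_range by (intro sum_mono mult_right_mono mult_left_mono) (auto simp: mult_left_le)
  finally show ?thesis by (simp add: sum_distrib_left mult.assoc)
qed

lemma prob_Markov:
  fixes f :: "nat set \<Rightarrow> real"
  assumes "measure_pmf.expectation M f \<le> B" "\<And>S. 0 \<le> f S" "t > 0"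
  shows "measure_pmf.prob M {S. \<not> f S \<le> t} \<le> B / t"
proof -
  have "measure_pmf.prob M {S. \<not> f S \<le> t} \<le> measure_pmf.prob M {S \<in> space M. f S \<ge> t}"
    by (intro measure_pmf.finite_measure_mono) auto
  also have "\<dots> \<le> measure_pmf.expectation M f / t"
    using assms by (intro integral_Markov_inequality_measure [of _ _ UNIV] integrable_sample) auto
  also have "\<dots> \<le> B / t" using assms by (intro divide_right_mono) auto
  finally show ?thesis .
qed

text \<open>Each entry is linear in the independent \<open>d S i\<close>, so its variance is bounded
  by a sum over \<open>i\<close>; summing over \<open>j\<close> and \<open>k\<close> first yields
  squares of square row norms. It serves both for \<open>M (D - p) M\<close> and for the Gram matrix
  of \<open>W\<close>.\<close>

lemma expectation_gram:
  assumes J: "finite J" and B: "\<And>i. i < n \<Longrightarrow> (\<Sum>j\<in>J. (f i j)\<^sup>2) \<le> B"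
  shows "measure_pmf.expectation M (\<lambda>S. \<Sum>j\<in>J. \<Sum>k\<in>J. (\<Sum>i<n. d S i * f i j * f i k)\<^sup>2) \<le> p * real n * B\<^sup>2"
proof -
  note [simp] = integrable_sample
  have "measure_pmf.expectation M (\<lambda>S. \<Sum>j\<in>J. \<Sum>k\<in>J. (\<Sum>i<n. d S i * f i j * f i k)\<^sup>2)
      = (\<Sum>j\<in>J. \<Sum>k\<in>J. measure_pmf.expectation M (\<lambda>S. (\<Sum>i<n. d S i * f i j * f i k)\<^sup>2))"
    by simp
  also have "\<dots> \<le> (\<Sum>j\<in>J. \<Sum>k\<in>J. p * (\<Sum>i<n. (f i j * f i k)\<^sup>2))"
    using expectation_square [of "{}" "{..<n}"]
    by (intro sum_mono) (simp add: mult.assoc)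
  also have "\<dots> = p * (\<Sum>j\<in>J. \<Sum>i<n. \<Sum>k\<in>J. (f i j * f i k)\<^sup>2)"
    unfolding sum_distrib_left [symmetric] by (subst sum.swap) (rule refl)
  also have "\<dots> = p * (\<Sum>i<n. (\<Sum>j\<in>J. (f i j)\<^sup>2)\<^sup>2)"
    by (subst sum.swap) (simp add: power2_eq_square sum_product mult_ac)
  also have "\<dots> \<le> p * (\<Sum>i<n. B\<^sup>2)"
    using p_range B by (intro mult_left_mono sum_mono power_mono sum_nonneg) auto
  finally show ?thesis by (simp add: mult.assoc)
qed

text \<open>The event \<open>{j, k} \<subseteq> S\<close> fixes \<open>d S j\<close> and
  \<open>d S k\<close>, so these terms are split off. Each is at most
  \<open>R * \<bar>a j k\<bar>\<close>, their sum has square at most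
  \<open>4 * R\<^sup>2 * (a j k)\<^sup>2\<close>, and
  \<open>(x + y)\<^sup>2 \<le> 2 * x\<^sup>2 + 2 * y\<^sup>2\<close> doubles this to the factor
  8.\<close>

lemma expectation_sampled_gram_entry:
  assumes jk: "j < n" "k < n" and R: "R \<ge> 0"
    and sym: "\<And>i l. i < n \<Longrightarrow> l < n \<Longrightarrow> a i l = a l i"
    and a: "\<And>i l. i < n \<Longrightarrow> l < n \<Longrightarrow> \<bar>a i l\<bar> \<le> R"
  shows "measure_pmf.expectation M (\<lambda>S. of_bool ({j, k} \<subseteq> S) * (\<Sum>i<n. d S i * a i j * a i k)\<^sup>2)
    \<le> p ^ card {j, k} * (2 * (p * (\<Sum>i<n. (a i j * a i k)\<^sup>2)) + 8 * R\<^sup>2 * (a j k)\<^sup>2)"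
proof -
  note [simp] = integrable_sample
  define I where "I = {..<n} - {j, k}"
  have I: "I \<subseteq> {..<n} - {j, k}" "I \<subseteq> {..<n}" by (auto simp: I_def)
  have jk': "{j, k} \<subseteq> {..<n}" using jk by auto
  have split: "(\<Sum>i<n. d S i * a i j * a i k)\<^sup>2
      \<le> 2 * (\<Sum>i\<in>I. d S i * (a i j * a i k))\<^sup>2 + 8 * R\<^sup>2 * (a j k)\<^sup>2" for S
  proof -
    define x where "x = (\<Sum>i\<in>I. d S i * (a i j * a i k))"
    define y where "y = (\<Sum>i\<in>{j, k}. d S i * (a i j * a i k))"
    have "(\<Sum>i<n. d S i * a i j * a i k) = x + y"
      unfolding x_def y_def I_def using jk' by (subst sum.subset_diff [of "{j, k}"]) (auto simp: mult.assoc)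
    moreover have "\<bar>y\<bar> \<le> \<bar>2 * R * a j k\<bar>"
    proof -
      have "\<bar>d S i * (a i j * a i k)\<bar> \<le> R * \<bar>a j k\<bar>" if "i \<in> {j, k}" for i
      proof -
        have "\<bar>d S i\<bar> \<le> 1" using p_range by (auto simp: d_def)
        moreover have "\<bar>a i j * a i k\<bar> \<le> R * \<bar>a j k\<bar>"
        proof (cases "i = j")
          case True
          then show ?thesis using a [of j j] jk by (simp add: abs_mult mult_right_mono)
        next
          case False
          then have "i = k" using that by simp
          have "\<bar>a k k\<bar> * \<bar>a j k\<bar> \<le> R * \<bar>a j k\<bar>" using a [of k k] jk by (intro mult_right_mono) auto
          then show ?thesis using \<open>i = k\<close> sym [of k j] jk by (simp add: abs_mult mult.commute)
        qed
        ultimately show ?thesis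
          unfolding abs_mult [of "d S i"] using mult_mono [of "\<bar>d S i\<bar>" 1 "\<bar>a i j * a i k\<bar>"] by simp
      qed
      then have "(\<Sum>i\<in>{j, k}. \<bar>d S i * (a i j * a i k)\<bar>) \<le> (\<Sum>i\<in>{j, k}. R * \<bar>a j k\<bar>)"
        by (rule sum_mono)
      also have "\<dots> = real (card {j, k}) * (R * \<bar>a j k\<bar>)" by simp
      also have "\<dots> \<le> 2 * (R * \<bar>a j k\<bar>)"
        using R by (intro mult_right_mono) (auto simp: card_insert_if)
      finally show ?thesis
        unfolding y_def using R sum_abs [of "\<lambda>i. d S i * (a i j * a i k)" "{j, k}"]
        by (simp add: abs_mult)
    qed
    then have "y\<^sup>2 \<le> 4 * R\<^sup>2 * (a j k)\<^sup>2"
      unfolding abs_le_square_iff by (simp add: power_mult_distrib)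
    moreover have "(x + y)\<^sup>2 \<le> 2 * x\<^sup>2 + 2 * y\<^sup>2"
      using zero_le_power2 [of "x - y"] by (simp add: power2_eq_square algebra_simps)
    ultimately show ?thesis unfolding x_def by simp
  qed
  have "measure_pmf.expectation M (\<lambda>S. of_bool ({j, k} \<subseteq> S) * (\<Sum>i<n. d S i * a i j * a i k)\<^sup>2)
    \<le> measure_pmf.expectation M (\<lambda>S. 2 * (of_bool ({j, k} \<subseteq> S) * (\<Sum>i\<in>I. d S i * (a i j * a i k))\<^sup>2)
        + 8 * R\<^sup>2 * (a j k)\<^sup>2 * of_bool ({j, k} \<subseteq> S))"
    using split by (intro expectation_mono) (auto simp: of_bool_def)
  also have "\<dots> = 2 * measure_pmf.expectation M
        (\<lambda>S. of_bool ({j, k} \<subseteq> S) * (\<Sum>i\<in>I. d S i * (a i j * a i k))\<^sup>2)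
      + 8 * R\<^sup>2 * (a j k)\<^sup>2 * p ^ card {j, k}"
    by (subst Bochner_Integration.integral_add; simp only: integrable_sample integral_mult_right_zero
      expectation_superset [OF jk'])
  also have "\<dots> \<le> 2 * (p ^ card {j, k} * (p * (\<Sum>i\<in>I. (a i j * a i k)\<^sup>2)))
      + 8 * R\<^sup>2 * (a j k)\<^sup>2 * p ^ card {j, k}"
    using expectation_square [OF jk' I(1), of "\<lambda>i. a i j * a i k"] by simp
  also have "\<dots> = p ^ card {j, k} * (2 * (p * (\<Sum>i\<in>I. (a i j * a i k)\<^sup>2)) + 8 * R\<^sup>2 * (a j k)\<^sup>2)"
    by (simp only: distrib_left mult_ac)
  also have "\<dots> \<le> p ^ card {j, k} * (2 * (p * (\<Sum>i<n. (a i j * a i k)\<^sup>2)) + 8 * R\<^sup>2 * (a j k)\<^sup>2)"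
    using p_range I by (intro mult_left_mono add_right_mono sum_mono2) auto
  finally show ?thesis .
qed

lemma expectation_sampled_gram:
  assumes R: "R \<ge> 0"
    and sym: "\<And>i l. i < n \<Longrightarrow> l < n \<Longrightarrow> a i l = a l i"
    and a: "\<And>i l. i < n \<Longrightarrow> l < n \<Longrightarrow> \<bar>a i l\<bar> \<le> R"
    and row: "\<And>i. i < n \<Longrightarrow> (\<Sum>j<n. (a i j)\<^sup>2) \<le> real n"
  defines "s \<equiv> p * real n"
  shows "measure_pmf.expectation M (\<lambda>S. \<Sum>j\<in>S. \<Sum>k\<in>S. (\<Sum>i<n. d S i * a i j * a i k)\<^sup>2)
    \<le> 2 * s ^ 3 + 10 * R\<^sup>2 * s\<^sup>2 + 8 * R ^ 4 * s"
proof -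
  note [simp] = integrable_sample
  define H where "H j k = 2 * (p * (\<Sum>i<n. (a i j * a i k)\<^sup>2)) + 8 * R\<^sup>2 * (a j k)\<^sup>2" for j k
  have H: "H j k \<ge> 0" for j k using p_range by (simp add: H_def sum_nonneg)
  have total: "(\<Sum>j<n. \<Sum>k<n. (a j k)\<^sup>2) \<le> (real n)\<^sup>2"
    using sum_mono [of "{..<n}" "\<lambda>j. \<Sum>k<n. (a j k)\<^sup>2" "\<lambda>_. real n"] row
    by (simp add: power2_eq_square)
  have "measure_pmf.expectation M (\<lambda>S. \<Sum>j\<in>S. \<Sum>k\<in>S. (\<Sum>i<n. d S i * a i j * a i k)\<^sup>2)
    \<le> measure_pmf.expectation M
        (\<lambda>S. \<Sum>j<n. \<Sum>k<n. of_bool ({j, k} \<subseteq> S) * (\<Sum>i<n. d S i * a i j * a i k)\<^sup>2)"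
  \<comment> \<open>An equality that is shown only on the support. It makes the ranges of summation
    independent of \<open>S\<close>, so that linearity applies.\<close>
  proof (intro expectation_mono eq_refl)
    fix S assume S: "S \<subseteq> {..<n}"
    have restrict: "(\<Sum>j\<in>S. f j) = (\<Sum>j<n. of_bool (j \<in> S) * f j)" for f :: "nat \<Rightarrow> real"
    proof -
      have "(\<Sum>j<n. of_bool (j \<in> S) * f j) = (\<Sum>j<n. if j \<in> S then f j else 0)"
        by (intro sum.cong) auto
      then show ?thesis using S by (simp add: sum.If_cases Int_absorb1)
    qed
    show "(\<Sum>j\<in>S. \<Sum>k\<in>S. (\<Sum>i<n. d S i * a i j * a i k)\<^sup>2)
      = (\<Sum>j<n. \<Sum>k<n. of_bool ({j, k} \<subseteq> S) * (\<Sum>i<n. d S i * a i j * a i k)\<^sup>2)"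
      unfolding restrict sum_distrib_left by (intro sum.cong refl) (auto simp: of_bool_def)
  qed
  also have "\<dots> = (\<Sum>j<n. \<Sum>k<n. measure_pmf.expectation M
      (\<lambda>S. of_bool ({j, k} \<subseteq> S) * (\<Sum>i<n. d S i * a i j * a i k)\<^sup>2))"
    by (simp only: integrable_sample Bochner_Integration.integral_sum)
  also have "\<dots> \<le> (\<Sum>j<n. \<Sum>k<n. p ^ card {j, k} * H j k)"
    unfolding H_def using R sym a by (intro sum_mono expectation_sampled_gram_entry) auto
  \<comment> \<open>For \<open>j = k\<close> the set \<open>{j, k}\<close> is a singleton and the
    weight is \<open>p\<close> instead of \<open>p\<^sup>2\<close>.\<close>
  also have "\<dots> \<le> (\<Sum>j<n. \<Sum>k<n. p\<^sup>2 * H j k + (p * H j k) * of_bool (j = k))"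
  proof (intro sum_mono)
    fix j k
    have "p ^ card {j, k} * H j k \<le> (p\<^sup>2 + p * of_bool (j = k)) * H j k"
      using H p_range by (intro mult_right_mono) (auto simp: card_insert_if power2_eq_square)
    then show "p ^ card {j, k} * H j k \<le> p\<^sup>2 * H j k + (p * H j k) * of_bool (j = k)"
      by (simp add: algebra_simps)
  qed
  also have "\<dots> = p\<^sup>2 * (\<Sum>j<n. \<Sum>k<n. H j k) + p * (\<Sum>j<n. H j j)"
    unfolding sum.distrib by (simp add: sum_delta_of_bool sum_distrib_left)
  \<comment> \<open>Multiplied out, the four terms are \<open>2 * s ^ 3\<close>,
    \<open>8 * R\<^sup>2 * s\<^sup>2\<close>, \<open>2 * R\<^sup>2 * s\<^sup>2\<close> and
    \<open>8 * R ^ 4 * s\<close>.\<close>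
  also have "\<dots> \<le> p\<^sup>2 * (2 * (p * real n ^ 3) + 8 * R\<^sup>2 * (real n)\<^sup>2)
      + p * (2 * p * R\<^sup>2 * (real n)\<^sup>2 + 8 * R ^ 4 * real n)"
  proof (intro add_mono mult_left_mono)
    have "(\<Sum>j<n. \<Sum>k<n. \<Sum>i<n. (a i j * a i k)\<^sup>2) = (\<Sum>i<n. (\<Sum>j<n. (a i j)\<^sup>2)\<^sup>2)"
    proof -
      have "(\<Sum>j<n. \<Sum>k<n. \<Sum>i<n. (a i j * a i k)\<^sup>2) = (\<Sum>j<n. \<Sum>i<n. \<Sum>k<n. (a i j * a i k)\<^sup>2)"
        by (intro sum.cong refl sum.swap)
      also have "\<dots> = (\<Sum>i<n. (\<Sum>j<n. (a i j)\<^sup>2)\<^sup>2)"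
        by (subst sum.swap) (simp add: power2_eq_square sum_product mult_ac)
      finally show ?thesis .
    qed
    also have "\<dots> \<le> (\<Sum>i<n. (real n)\<^sup>2)"
      using row by (intro sum_mono power_mono sum_nonneg) auto
    finally have "(\<Sum>j<n. \<Sum>k<n. \<Sum>i<n. (a i j * a i k)\<^sup>2) \<le> real n ^ 3"
      by (simp add: power2_eq_square power3_eq_cube)
    then have "p * (\<Sum>j<n. \<Sum>k<n. \<Sum>i<n. (a i j * a i k)\<^sup>2) \<le> p * real n ^ 3"
      using p_range(1) by (rule mult_left_mono)
    moreover have "R\<^sup>2 * (\<Sum>j<n. \<Sum>k<n. (a j k)\<^sup>2) \<le> R\<^sup>2 * (real n)\<^sup>2"
      using total by (intro mult_left_mono) auto
    moreover have "(\<Sum>j<n. \<Sum>k<n. H j k) = 2 * (p * (\<Sum>j<n. \<Sum>k<n. \<Sum>i<n. (a i j * a i k)\<^sup>2))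
        + 8 * (R\<^sup>2 * (\<Sum>j<n. \<Sum>k<n. (a j k)\<^sup>2))"
      by (simp add: H_def sum.distrib sum_distrib_left mult.assoc)
    ultimately show "(\<Sum>j<n. \<Sum>k<n. H j k) \<le> 2 * (p * real n ^ 3) + 8 * R\<^sup>2 * (real n)\<^sup>2"
      by linarith
    have sq: "(a i l)\<^sup>2 \<le> R\<^sup>2" if "i < n" "l < n" for i l
      using a [OF that] R by (simp add: abs_le_square_iff [symmetric])
    have "(\<Sum>j<n. \<Sum>i<n. (a i j * a i j)\<^sup>2) = (\<Sum>i<n. \<Sum>j<n. (a i j)\<^sup>2 * (a i j)\<^sup>2)"
      by (subst sum.swap) (simp add: power_mult_distrib)
    also have "\<dots> \<le> (\<Sum>i<n. \<Sum>j<n. R\<^sup>2 * (a i j)\<^sup>2)"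
      using sq by (intro sum_mono mult_right_mono) auto
    also have "\<dots> \<le> R\<^sup>2 * (real n)\<^sup>2"
      unfolding sum_distrib_left [symmetric] using total by (intro mult_left_mono) auto
    finally have "p * (\<Sum>j<n. \<Sum>i<n. (a i j * a i j)\<^sup>2) \<le> p * (R\<^sup>2 * (real n)\<^sup>2)"
      using p_range(1) by (rule mult_left_mono)
    moreover have "R\<^sup>2 * (\<Sum>j<n. (a j j)\<^sup>2) \<le> R\<^sup>2 * (real n * R\<^sup>2)"
      using sum_mono [of "{..<n}" "\<lambda>j. (a j j)\<^sup>2" "\<lambda>_. R\<^sup>2"] sq by (intro mult_left_mono) auto
    moreover have "(\<Sum>j<n. H j j) = 2 * (p * (\<Sum>j<n. \<Sum>i<n. (a i j * a i j)\<^sup>2)) + 8 * (R\<^sup>2 * (\<Sum>j<n. (a j j)\<^sup>2))"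
      by (simp add: H_def sum.distrib sum_distrib_left mult.assoc)
    moreover have "R\<^sup>2 * (real n * R\<^sup>2) = R ^ 4 * real n" by (simp add: power2_eq_square power4_eq_xxxx)
    ultimately show "(\<Sum>j<n. H j j) \<le> 2 * p * R\<^sup>2 * (real n)\<^sup>2 + 8 * R ^ 4 * real n" by linarith
  qed (use p_range in auto)
  also have "\<dots> = 2 * s ^ 3 + 10 * R\<^sup>2 * s\<^sup>2 + 8 * R ^ 4 * s"
    by (simp add: s_def power2_eq_square power3_eq_cube algebra_simps)
  finally show ?thesis .
qed

end

subsection \<open>Approximation of the spectrum\<close>

text \<open>The top of the spectrum uses the locale facts for \<open>lam\<close>, the bottom those
  for \<open>- lam\<close>. The constant is \<open>5 = 3 + 2\<close>: in the worst case an
  eigenvalue of modulus up to \<open>3 * e * n\<close> meets an estimate of opposite sign and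
  modulus up to \<open>2 * e * n\<close>.\<close>

lemma approx_eig_close:
  fixes A :: "real mat" and e p :: real
  defines "lam \<equiv> \<lambda>j. eig A (Suc j)"
  assumes A: "A \<in> carrier_mat n n" and sym: "transpose_mat A = A" and S: "S \<subseteq> {..<n}"
    and i: "i \<in> {1..n}" and p: "p > 0" and e: "e > 0"
    and spectrum: "sampled_spectrum n (card S) S K v u lam
      (\<lambda>q. eig (principal_submatrix A S) (Suc q)) p (e * (p * real n))"
    and K: "\<And>j. j < n \<Longrightarrow> 3 * e * real n \<le> \<bar>lam j\<bar> \<Longrightarrow> j \<in> K"
  shows "\<bar>approx_eig A (p * real n) S i - eig A i\<bar> \<le> 5 * e * real n"
proof -
  define m where "m = card S"
  define mu where "mu = (\<lambda>q. eig (principal_submatrix A S) (Suc q))"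
  define b where "b = e * real n"
  define r where "r = e * (p * real n)"
  have n: "real n > 0" using i by simp
  have b: "b > 0" and rb: "r = p * b" using e n by (simp_all add: b_def r_def)
  interpret pos: sampled_spectrum n m S K v u lam mu p r
    using spectrum unfolding m_def mu_def r_def .
  interpret neg: sampled_spectrum n m S K v u "\<lambda>j. - lam j" "\<lambda>q. - mu q" p r
    by (rule pos.sampled_spectrum_uminus)
  note B = principal_submatrix_symmetric [OF A sym S]
  have mn: "m \<le> n" unfolding m_def using card_mono [OF _ S] by simp
  have lam: "lam k \<le> lam j" if "j \<le> k" "k < n" for j k
    unfolding lam_def using that by (intro eig_antimono [OF A sym]) auto
  have mu: "mu k \<le> mu j" if "j \<le> k" "k < m" for j k
    unfolding mu_def using that by (intro eig_antimono [OF B]) (auto simp: m_def)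
  have K': "j \<in> K" if "j < n" "3 * b \<le> \<bar>lam j\<bar>" for j
    using K that by (simp add: b_def)

  \<comment> \<open>\<open>{..q}\<close> has one element more than \<open>{..<q}\<close>, so equal
    ranks from the top are compared.\<close>
  have upper: "mu q \<le> p * (max (lam q) 0 + 2 * b)" if "q < m" for q
  proof -
    have "mu q \<le> p * max (lam q) 0 + 2 * r"
    proof (rule pos.sampled_eigenvalue_upper)
      show "lam j \<le> max (lam q) 0" if "j \<in> {..<n} - {..<q}" for j
        using lam [of q j] that by auto
      show "mu q \<le> mu q'" if "q' \<in> {..q}" for q' using mu [of q' q] that \<open>q < m\<close> by auto
    qed (use that mn in auto)
    then show ?thesis by (simp add: rb distrib_left)
  qed
  \<comment> \<open>Now counted from the bottom: rank \<open>q\<close> of the submatrix corresponds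
    to rank \<open>n - m + q\<close> of \<open>A\<close>, beyond which there are
    \<open>m - q - 1\<close> indices.\<close>
  have upper': "p * (max (- lam (n - m + q)) 0 + 2 * b) \<ge> - mu q" if "q < m" for q
  proof -
    have "- mu q \<le> p * max (- lam (n - m + q)) 0 + 2 * r"
    proof (rule neg.sampled_eigenvalue_upper)
      show "{n - m + q<..<n} \<subseteq> {..<n}" by auto
      show "{q..<m} \<subseteq> {..<m}" by auto
      show "card {n - m + q<..<n} < card {q..<m}" using that mn by simp
      show "- lam j \<le> max (- lam (n - m + q)) 0" if "j \<in> {..<n} - {n - m + q<..<n}" for j
      proof -
        have "lam (n - m + q) \<le> lam j" using that \<open>q < m\<close> mn by (intro lam) auto
        then show ?thesis by linarith
      qed
      show "- mu q \<le> - mu q'" if "q' \<in> {q..<m}" for q' using mu [of q q'] that by auto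
    qed auto
    then show ?thesis by (simp add: rb distrib_left)
  qed
  have lower: "j < m \<and> p * (lam j - 3 * b) \<le> mu j" if "j < n" "3 * b \<le> lam j" for j
  proof -
    \<comment> \<open>For \<open>m \<le> j\<close> the set of candidates would be empty, so the
      existence of \<open>q\<close> also proves \<open>j < m\<close>.\<close>
    have "\<exists>q\<in>{..<m} - {..<min j m}. p * lam j - 3 * r \<le> mu q"
    proof (rule pos.sampled_eigenvalue_lower)
      show "{..j} \<subseteq> K"
      proof
        fix k assume "k \<in> {..j}"
        then show "k \<in> K" using lam [of k j] that by (intro K') auto
      qed
      show "lam j \<le> lam k" if "k \<in> {..j}" for k using lam [of k j] that \<open>j < n\<close> by auto
      show "3 * r \<le> p * lam j" using that(2) p by (simp add: rb mult.left_commute)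
    qed auto
    then obtain q where "q \<in> {..<m} - {..<min j m}" and q: "p * lam j - 3 * r \<le> mu q" by blast
    then have "min j m \<le> q" "q < m" by auto
    then have "j \<le> q" "q < m" by linarith+
    then show ?thesis using q mu [of j q] by (simp add: rb algebra_simps)
  qed
  have lower': "n \<le> j + m \<and> mu (j + m - n) \<le> p * (lam j + 3 * b)" if "j < n" "lam j \<le> - 3 * b" for j
  proof -
    \<comment> \<open>The excluded indices are those with \<open>q > j + m - n\<close>, written
      additively to avoid truncated subtraction; there are at most \<open>n - j - 1\<close> of
      them.\<close>
    have "\<exists>q\<in>{..<m} - {q. q < m \<and> j + m < q + n}. p * - lam j - 3 * r \<le> - mu q"
    proof (rule neg.sampled_eigenvalue_lower)
      show "{j..<n} \<subseteq> K"
      proof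
        fix k assume "k \<in> {j..<n}"
        then show "k \<in> K" using lam [of j k] that b by (intro K') auto
      qed
      show "- lam j \<le> - lam k" if "k \<in> {j..<n}" for k using lam [of j k] that by auto
      have "p * (3 * b) \<le> p * - lam j" using that(2) p by (intro mult_left_mono) auto
      then show "3 * r \<le> p * - lam j" by (simp add: rb)
      show "{q. q < m \<and> j + m < q + n} \<subseteq> {..<m}" by auto
      have "card {q. q < m \<and> j + m < q + n} \<le> card {m - (n - Suc j)..<m}"
        using that(1) mn by (intro card_mono) auto
      then show "card {q. q < m \<and> j + m < q + n} < card {j..<n}" using that(1) by simp
    qed
    then obtain q where "q \<in> {..<m} - {q. q < m \<and> j + m < q + n}"
      and q: "p * - lam j - 3 * r \<le> - mu q" by blast
    then have "q + n \<le> j + m" "q < m" by auto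
    then have "n \<le> j + m" "mu (j + m - n) \<le> mu q" using that(1) by (auto intro: mu)
    then show ?thesis using q by (simp add: rb algebra_simps)
  qed

  define j where "j = i - 1"
  have j: "i = Suc j" "j < n" using i by (auto simp: j_def)
  define X where "X = approx_eig A (p * real n) S i"
  have scale: "real n / (p * real n) * y = y / p" for y using n by simp
  \<comment> \<open>\<open>approx_eig\<close> with ranks counted from 0.\<close>
  have X: "X = (if j < m \<and> mu j \<ge> 0 then mu j / p
      else if n \<le> j + m \<and> mu (j + m - n) < 0 then mu (j + m - n) / p else 0)"
  proof -
    have "Suc j + m - n = Suc (j + m - n)" if "n \<le> j + m" using that by simp
    then show ?thesis
      using A j unfolding X_def approx_eig_def Let_def mu_def m_def [symmetric] scale j(1)
      by auto
  qed
  have "\<bar>X - lam j\<bar> \<le> 5 * b"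
  proof (cases "j < m \<and> mu j \<ge> 0")
    case True
    then have X: "X = mu j / p" and X0: "X \<ge> 0" using X p by auto
    have 1: "X \<le> max (lam j) 0 + 2 * b"
      using upper [of j] True p unfolding X by (simp add: pos_divide_le_eq mult.commute)
    have 2: "lam j - 3 * b \<le> X" if "3 * b \<le> lam j"
      using lower [OF j(2) that] p unfolding X by (simp add: pos_le_divide_eq mult.commute)
    \<comment> \<open>Otherwise \<open>lower'\<close> makes \<open>mu (j + m - n)\<close> negative,
      although \<open>j + m - n \<le> j\<close> and \<open>mu j \<ge> 0\<close>.\<close>
    have "- 3 * b \<le> lam j"
    proof (rule ccontr)
      assume "\<not> ?thesis"
      then have *: "lam j < - 3 * b" by simp
      then have "mu (j + m - n) \<le> p * (lam j + 3 * b)" using lower' [OF j(2)] by auto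
      also have "\<dots> < 0" using * p by (intro mult_pos_neg) auto
      also have "0 \<le> mu j" using True by simp
      also have "mu j \<le> mu (j + m - n)" using True mn by (intro mu) auto
      finally show False by simp
    qed
    then show ?thesis using 1 2 X0 b by linarith
  next
    case False
    have 1: "lam j \<le> 3 * b"
    proof (rule ccontr)
      assume "\<not> ?thesis"
      then have *: "3 * b < lam j" by simp
      then have "0 < p * (lam j - 3 * b)" using p by simp
      then show False using lower [OF j(2)] * False by auto
    qed
    show ?thesis
    proof (cases "n \<le> j + m \<and> mu (j + m - n) < 0")
      case True
      then have X: "X = mu (j + m - n) / p" and X0: "X \<le> 0"
        using X False p by (auto simp: divide_le_0_iff)
      have "j + m - n < m" "n - m + (j + m - n) = j" using True j(2) mn by auto
      then have "- mu (j + m - n) \<le> p * (max (- lam j) 0 + 2 * b)"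
        using upper' [of "j + m - n"] by simp
      then have "p * - X \<le> p * (max (- lam j) 0 + 2 * b)" using p X by simp
      then have "- X \<le> max (- lam j) 0 + 2 * b" by (simp only: mult_le_cancel_left_pos [OF p])
      moreover have "X \<le> lam j + 3 * b" if "lam j \<le> - 3 * b"
        using lower' [OF j(2) that] p unfolding X by (simp add: pos_divide_le_eq mult.commute)
      ultimately show ?thesis using 1 X0 b by linarith
    next
      case X': False
      have "- 3 * b \<le> lam j"
      proof (rule ccontr)
        assume "\<not> ?thesis"
        then have *: "lam j < - 3 * b" by simp
        then have "p * (lam j + 3 * b) < 0" using p by (intro mult_pos_neg) auto
        then show False using lower' [OF j(2)] * X' by auto
      qed
      then show ?thesis using X X' False 1 b by auto
    qed
  qed
  then show ?thesis by (simp add: X_def b_def lam_def j(1))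
qed

section \<open>The probability of a good sample\<close>

text \<open>Three uses of Markov's inequality and a union bound, with
  \<open>2980 = 16 + 2960 + 4\<close>. The assumption \<open>large\<close> absorbs the lower-order
  terms of \<open>expectation_sampled_gram\<close>.\<close>

lemma sampled_eigenvalues_close_prob:
  fixes A :: "real mat" and e p :: real
  assumes A: "A \<in> carrier_mat n n" and sym: "transpose_mat A = A"
    and A1: "\<And>i k. i < n \<Longrightarrow> k < n \<Longrightarrow> \<bar>A $$ (i, k)\<bar> \<le> 1"
    and e: "e > 0" "e < 1" and p: "p > 0" "p \<le> 1" and large: "1 \<le> e ^ 4 * (p * real n)"
  shows "measure_pmf.prob (random_subset n p)
      {S. \<forall>i\<in>{1..n}. \<bar>approx_eig A (p * real n) S i - eig A i\<bar> \<le> 5 * e * real n}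
    \<ge> 1 - 2980 / (e ^ 4 * (p * real n))"
proof -
  interpret bernoulli_sample n p using p by unfold_locales auto
  define s where "s = p * real n"
  define lam where "lam = (\<lambda>j. eig A (Suc j))"
  obtain v where v: "orthonormal {..<n} {..<n} v"
    and Av: "\<And>i k. i < n \<Longrightarrow> k < n \<Longrightarrow> A $$ (i, k) = (\<Sum>j<n. lam j * v j i * v j k)"
    using spectral_decomposition [OF A sym] unfolding lam_def by metis
  have "n \<noteq> 0" using large by (intro notI) simp
  then have n: "real n > 0" by simp
  have s: "s > 0" unfolding s_def using p n by simp
  define \<theta> where "\<theta> = e * real n / 2"
  have \<theta>: "\<theta> > 0" using e n by (simp add: \<theta>_def)
  define K where "K = {j. j < n \<and> \<theta> \<le> \<bar>lam j\<bar>}"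
  define J where "J = {..<n} - K"
  have KJ: "K \<subseteq> {..<n}" "J \<subseteq> {..<n}" "finite K" "finite J" by (auto simp: K_def J_def)
  define f where "f i j = sqrt \<bar>lam j\<bar> * v j i" for i j
  define a where "a i k = (\<Sum>j\<in>J. lam j * v j i * v j k)" for i k

  \<comment> \<open>Parseval moves the rows of \<open>A\<close> to spectral coordinates, where
    restricting to \<open>K\<close> or \<open>J\<close> only shrinks the sum.\<close>
  have rowA: "(\<Sum>j<n. (lam j * v j i)\<^sup>2) \<le> real n" if "i < n" for i
  proof -
    have "(\<Sum>j<n. (lam j * v j i)\<^sup>2) = (\<Sum>k<n. (\<Sum>j<n. v j k * (lam j * v j i))\<^sup>2)"
      using v by (intro parseval [symmetric]) auto
    also have "\<dots> = (\<Sum>k<n. (A $$ (i, k))\<^sup>2)"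
      using that Av by (intro sum.cong refl) (simp add: mult_ac)
    also have "\<dots> \<le> (\<Sum>k<n. 1)"
      using A1 that by (intro sum_mono) (simp add: abs_square_le_1)
    finally show ?thesis by simp
  qed
  have rowa: "(\<Sum>k<n. (a i k)\<^sup>2) \<le> real n" if "i < n" for i
  proof -
    have "(\<Sum>k<n. (a i k)\<^sup>2) = (\<Sum>k<n. (\<Sum>j\<in>J. v j k * (lam j * v j i))\<^sup>2)"
      unfolding a_def by (simp only: mult_ac)
    also have "\<dots> = (\<Sum>j\<in>J. (lam j * v j i)\<^sup>2)"
      using KJ orthonormal_subset [OF v] by (intro parseval) auto
    also have "\<dots> \<le> (\<Sum>j<n. (lam j * v j i)\<^sup>2)" using KJ by (intro sum_mono2) auto
    finally show ?thesis using rowA [OF that] by linarith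
  qed
  \<comment> \<open>On \<open>K\<close> one has
    \<open>\<theta> * \<bar>lam j\<bar> \<le> (lam j)\<^sup>2\<close>, so the bound is
    \<open>n / \<theta> = 2 / e\<close>.\<close>
  have rowf: "(\<Sum>j\<in>K. (f i j)\<^sup>2) \<le> 2 / e" if "i < n" for i
  proof -
    have "\<theta> * (\<Sum>j\<in>K. (f i j)\<^sup>2) = (\<Sum>j\<in>K. (\<theta> * \<bar>lam j\<bar>) * (v j i)\<^sup>2)"
      by (simp add: f_def power_mult_distrib sum_distrib_left mult.assoc)
    also have "\<dots> \<le> (\<Sum>j\<in>K. (lam j * v j i)\<^sup>2)"
    proof (intro sum_mono)
      fix j assume "j \<in> K"
      then have "\<theta> * \<bar>lam j\<bar> \<le> \<bar>lam j\<bar> * \<bar>lam j\<bar>" by (intro mult_right_mono) (auto simp: K_def)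
      then show "\<theta> * \<bar>lam j\<bar> * (v j i)\<^sup>2 \<le> (lam j * v j i)\<^sup>2"
        unfolding power_mult_distrib by (intro mult_right_mono) (auto simp: power2_eq_square)
    qed
    also have "\<dots> \<le> (\<Sum>j<n. (lam j * v j i)\<^sup>2)" using KJ by (intro sum_mono2) auto
    also have "\<dots> \<le> \<theta> * (2 / e)" using rowA [OF that] e by (simp add: \<theta>_def)
    finally show ?thesis using \<theta> by (simp only: mult_le_cancel_left_pos)
  qed
  \<comment> \<open>\<open>M\<close> is \<open>A\<close> minus its outlying part; the entries of the
    latter are at most \<open>2 / e\<close> by \<open>rowf\<close> and the inequality of
    means.\<close>
  have entry: "\<bar>a i k\<bar> \<le> 3 / e" if "i < n" "k < n" for i k
  proof -
    have "A $$ (i, k) = (\<Sum>j\<in>K. lam j * v j i * v j k) + a i k"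
      unfolding Av [OF that] a_def J_def using KJ by (subst sum.subset_diff [of K]) auto
    moreover have "\<bar>\<Sum>j\<in>K. lam j * v j i * v j k\<bar> \<le> 2 / e"
    proof -
      have "\<bar>\<Sum>j\<in>K. lam j * v j i * v j k\<bar> \<le> (\<Sum>j\<in>K. \<bar>lam j * v j i * v j k\<bar>)" by (rule sum_abs)
      also have "\<dots> \<le> (\<Sum>j\<in>K. ((f i j)\<^sup>2 + (f k j)\<^sup>2) / 2)"
      proof (intro sum_mono)
        fix j
        have "\<bar>lam j * v j i * v j k\<bar> = \<bar>f i j\<bar> * \<bar>f k j\<bar>" by (simp add: f_def abs_mult)
        also have "\<dots> \<le> ((f i j)\<^sup>2 + (f k j)\<^sup>2) / 2"
          using sum_squares_bound [of "\<bar>f i j\<bar>" "\<bar>f k j\<bar>"] by simp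
        finally show "\<bar>lam j * v j i * v j k\<bar> \<le> ((f i j)\<^sup>2 + (f k j)\<^sup>2) / 2" .
      qed
      also have "\<dots> = ((\<Sum>j\<in>K. (f i j)\<^sup>2) + (\<Sum>j\<in>K. (f k j)\<^sup>2)) / 2"
        by (simp add: sum.distrib sum_divide_distrib [symmetric])
      also have "\<dots> \<le> (2 / e + 2 / e) / 2"
        using that by (intro divide_right_mono add_mono rowf) auto
      also have "\<dots> = 2 / e" by simp
      finally show ?thesis .
    qed
    ultimately have "\<bar>a i k\<bar> \<le> 1 + 2 / e" using A1 [OF that] by linarith
    also have "\<dots> \<le> 1 / e + 2 / e" using e by (intro add_right_mono) simp
    finally show ?thesis by (simp add: add_divide_distrib [symmetric])
  qed
  have syma: "a i k = a k i" for i k unfolding a_def by (simp only: mult_ac)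

  define F1 where "F1 S = (\<Sum>j<n. \<Sum>k<n. (\<Sum>i<n. d S i * a i j * a i k)\<^sup>2)" for S
  define F2 where "F2 S = (\<Sum>j\<in>S. \<Sum>k\<in>S. (\<Sum>i<n. d S i * a i j * a i k)\<^sup>2)" for S
  define F3 where "F3 S = (\<Sum>j\<in>K. \<Sum>k\<in>K. (\<Sum>i<n. d S i * f i j * f i k)\<^sup>2)" for S
  have F0: "0 \<le> F1 S" "0 \<le> F2 S" "0 \<le> F3 S" for S
    by (auto simp: F1_def F2_def F3_def intro!: sum_nonneg)
  \<comment> \<open>Together with \<open>\<theta>\<close>, the tolerances give
    \<open>p * (p * \<theta>\<^sup>2 + r1) + r2 = (e * s)\<^sup>2\<close>, in shares of 1/4, 1/4 and
    1/2.\<close>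
  define r1 where "r1 = e\<^sup>2 * s * real n / 4"
  define r2 where "r2 = e\<^sup>2 * s\<^sup>2 / 2"
  have r12: "r1 > 0" "r2 > 0" using e s n by (simp_all add: r1_def r2_def)
  have B1: "measure_pmf.prob M {S. \<not> F1 S \<le> r1\<^sup>2} \<le> 16 / (e ^ 4 * s)"
  proof -
    have "measure_pmf.expectation M F1 \<le> p * real n * (real n)\<^sup>2"
      unfolding F1_def using rowa by (intro expectation_gram) auto
    then have "measure_pmf.prob M {S. \<not> F1 S \<le> r1\<^sup>2} \<le> p * real n * (real n)\<^sup>2 / r1\<^sup>2"
      using r12 F0 by (intro prob_Markov) auto
    also have "\<dots> = 16 / (e ^ 4 * s)"
      using e s n by (simp add: r1_def s_def [symmetric] power_mult_distrib power_divide
        field_simps power2_eq_square power4_eq_xxxx)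
    finally show ?thesis .
  qed
  have B2: "measure_pmf.prob M {S. \<not> F2 S \<le> r2\<^sup>2} \<le> 2960 / (e ^ 4 * s)"
  proof -
    have E2: "measure_pmf.expectation M F2 \<le> 2 * s ^ 3 + 10 * (3 / e)\<^sup>2 * s\<^sup>2 + 8 * (3 / e) ^ 4 * s"
      unfolding F2_def s_def using e syma entry rowa by (intro expectation_sampled_gram) auto
    \<comment> \<open>Each term of \<open>E2\<close> is brought to a multiple of
      \<open>s ^ 3\<close>, with total \<open>2 + 90 + 648 = 740\<close>; division by
      \<open>r2\<^sup>2 = e ^ 4 * s ^ 4 / 4\<close> then gives 2960.\<close>
    have i4: "1 / e ^ 4 \<le> s" using large e by (simp add: s_def divide_le_eq mult.commute)
    have "e ^ 4 \<le> e\<^sup>2" "e ^ 4 \<le> 1" using e by (auto intro!: power_decreasing power_le_one)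
    then have "1 / e\<^sup>2 \<le> 1 / e ^ 4" "1 \<le> 1 / e ^ 4" using e by (auto intro!: divide_left_mono)
    then have i2: "1 / e\<^sup>2 \<le> s" and s1: "1 \<le> s" using i4 by linarith+
    have "10 * (3 / e)\<^sup>2 * s\<^sup>2 = 90 * (1 / e\<^sup>2 * s\<^sup>2)" by (simp add: power_divide)
    also have "\<dots> \<le> 90 * (s * s\<^sup>2)" using i2 by (intro mult_left_mono mult_right_mono) auto
    finally have 1: "10 * (3 / e)\<^sup>2 * s\<^sup>2 \<le> 90 * s ^ 3" by (simp add: power3_eq_cube power2_eq_square)
    have "8 * (3 / e) ^ 4 * s = 648 * (1 / e ^ 4 * s)" by (simp add: power_divide)
    also have "\<dots> \<le> 648 * (s * s)" using i4 s by (intro mult_left_mono mult_right_mono) auto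
    also have "\<dots> \<le> 648 * (s * s * s)" using s1 s by simp
    finally have "8 * (3 / e) ^ 4 * s \<le> 648 * s ^ 3" by (simp add: power3_eq_cube)
    with E2 1 have "measure_pmf.expectation M F2 \<le> 740 * s ^ 3" by linarith
    then have "measure_pmf.prob M {S. \<not> F2 S \<le> r2\<^sup>2} \<le> 740 * s ^ 3 / r2\<^sup>2"
      using r12 F0 by (intro prob_Markov) auto
    also have "\<dots> = 2960 / (e ^ 4 * s)"
      using e s by (simp add: r2_def power_mult_distrib power_divide
        field_simps power2_eq_square power3_eq_cube power4_eq_xxxx)
    finally show ?thesis .
  qed
  have B3: "measure_pmf.prob M {S. \<not> F3 S \<le> (e * s)\<^sup>2} \<le> 4 / (e ^ 4 * s)"
  proof -
    have "measure_pmf.expectation M F3 \<le> p * real n * (2 / e)\<^sup>2"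
      unfolding F3_def using rowf KJ by (intro expectation_gram) auto
    then have "measure_pmf.prob M {S. \<not> F3 S \<le> (e * s)\<^sup>2} \<le> p * real n * (2 / e)\<^sup>2 / (e * s)\<^sup>2"
      using e s F0 by (intro prob_Markov) auto
    also have "\<dots> = 4 / (e ^ 4 * s)"
      using e s by (simp add: s_def [symmetric] power_mult_distrib power_divide
        field_simps power2_eq_square power4_eq_xxxx)
    finally show ?thesis .
  qed

  define G where "G = {S. \<forall>i\<in>{1..n}. \<bar>approx_eig A (p * real n) S i - eig A i\<bar> \<le> 5 * e * real n}"
  have good: "S \<in> G"
    if S: "S \<subseteq> {..<n}" and F: "F1 S \<le> r1\<^sup>2" "F2 S \<le> r2\<^sup>2" "F3 S \<le> (e * s)\<^sup>2" for S
  proof -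
    have finS: "finite S" using S finite_subset by blast
    obtain u where u: "orthonormal {..<card S} S u" "orthonormal S {..<card S} (\<lambda>i q. u q i)"
      "\<And>i k. i \<in> S \<Longrightarrow> k \<in> S \<Longrightarrow>
        A $$ (i, k) = (\<Sum>q<card S. eig (principal_submatrix A S) (Suc q) * u q i * u q k)"
      using principal_submatrix_spectral_decomposition [OF A sym S] by metis
    have dsum: "(\<Sum>i<n. d S i * g i) = (\<Sum>i\<in>S. g i) - p * (\<Sum>i<n. g i)" for g
    proof -
      have "(\<Sum>i<n. d S i * g i) = (\<Sum>i<n. (if i \<in> S then g i else 0) - p * g i)"
        by (intro sum.cong refl) (auto simp: d_def algebra_simps)
      then show ?thesis
        using S by (simp add: sum_subtractf sum.If_cases Int_absorb1 sum_distrib_left)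
    qed
    have spectrum: "sampled_spectrum n (card S) S K v u lam
        (\<lambda>q. eig (principal_submatrix A S) (Suc q)) p (e * s)"
    proof
      show "(\<Sum>q<card S. eig (principal_submatrix A S) (Suc q) * u q i * u q k)
        = (\<Sum>j<n. lam j * v j i * v j k)" if "i \<in> S" "k \<in> S" for i k
        using u(3) [OF that] Av [of i k] that S by auto
      \<comment> \<open>By orthonormality the full Gram matrix of \<open>W\<close> is the diagonal
        matrix of the \<open>\<bar>lam j\<bar>\<close>, so the Gram error is a sum weighted with
        \<open>d\<close>.\<close>
      have "(\<Sum>i\<in>S. (sqrt \<bar>lam j\<bar> * v j i) * (sqrt \<bar>lam k\<bar> * v k i)) - p * \<bar>lam j\<bar> * of_bool (j = k)
          = (\<Sum>i<n. d S i * f i j * f i k)" if "j \<in> K" "k \<in> K" for j k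
      proof -
        have "(\<Sum>i<n. f i j * f i k) = sqrt \<bar>lam j\<bar> * sqrt \<bar>lam k\<bar> * (\<Sum>i<n. v j i * v k i)"
          by (simp add: f_def sum_distrib_left mult_ac)
        also have "\<dots> = \<bar>lam j\<bar> * of_bool (j = k)"
        proof -
          have "j \<in> {..<n}" "k \<in> {..<n}" using that KJ(1) by blast+
          from orthonormalD [OF v this] show ?thesis by auto
        qed
        finally show ?thesis
          using dsum [of "\<lambda>i. f i j * f i k"] by (simp add: f_def mult.assoc)
      qed
      then have "(\<Sum>j\<in>K. \<Sum>k\<in>K. ((\<Sum>i\<in>S. (sqrt \<bar>lam j\<bar> * v j i) * (sqrt \<bar>lam k\<bar> * v k i))
        - p * \<bar>lam j\<bar> * of_bool (j = k))\<^sup>2) = F3 S"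
        unfolding F3_def by (intro sum.cong refl) simp
      then show "(\<Sum>j\<in>K. \<Sum>k\<in>K. ((\<Sum>i\<in>S. (sqrt \<bar>lam j\<bar> * v j i) * (sqrt \<bar>lam k\<bar> * v k i))
        - p * \<bar>lam j\<bar> * of_bool (j = k))\<^sup>2) \<le> (e * s)\<^sup>2" using F by simp
      show "\<bar>\<Sum>j\<in>{..<n} - K. lam j * (\<Sum>i\<in>S. v j i * x i)\<^sup>2\<bar> \<le> e * s * (\<Sum>i\<in>S. (x i)\<^sup>2)" for x
        unfolding J_def [symmetric]
      proof (rule sampled_form_bound [OF v KJ(2) S _ a_def])
        show "\<bar>lam j\<bar> \<le> \<theta>" if "j \<in> J" for j using that by (auto simp: J_def K_def)
        show "(\<Sum>j<n. \<Sum>k<n. (\<Sum>i<n. (of_bool (i \<in> S) - p) * a i j * a i k)\<^sup>2) \<le> r1\<^sup>2"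
          using F by (simp add: F1_def d_def)
        show "(\<Sum>j\<in>S. \<Sum>k\<in>S. (\<Sum>i<n. (of_bool (i \<in> S) - p) * a i j * a i k)\<^sup>2) \<le> r2\<^sup>2"
          using F by (simp add: F2_def d_def)
        have "p * (p * \<theta>\<^sup>2 + r1) + r2 = (e * s)\<^sup>2"
          by (simp add: \<theta>_def r1_def r2_def s_def power2_eq_square algebra_simps)
        then show "p * (p * \<theta>\<^sup>2 + r1) + r2 \<le> (e * s)\<^sup>2" by simp
      qed (use r12 p e s in auto)
    qed (use u finS KJ p e s in auto)
    show ?thesis unfolding G_def
    proof (intro CollectI ballI)
      fix i assume i: "i \<in> {1..n}"
      show "\<bar>approx_eig A (p * real n) S i - eig A i\<bar> \<le> 5 * e * real n"
      proof (rule approx_eig_close [OF A sym S i p(1) e(1)])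
        show "sampled_spectrum n (card S) S K v u (\<lambda>j. eig A (Suc j))
          (\<lambda>q. eig (principal_submatrix A S) (Suc q)) p (e * (p * real n))"
          using spectrum unfolding lam_def s_def .
        fix j assume j: "j < n" "3 * e * real n \<le> \<bar>eig A (Suc j)\<bar>"
        moreover have "\<theta> \<le> 3 * e * real n" using e n by (simp add: \<theta>_def)
        ultimately show "j \<in> K" by (simp add: K_def lam_def)
      qed
    qed
  qed
  \<comment> \<open>By \<open>good\<close>, a sample outside \<open>G\<close> violates one of the
    three bounds.\<close>
  have "1 = measure_pmf.prob M
    (G \<union> ({S. \<not> F1 S \<le> r1\<^sup>2} \<union> ({S. \<not> F2 S \<le> r2\<^sup>2} \<union> {S. \<not> F3 S \<le> (e * s)\<^sup>2})))"
    using good set_pmf_sample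
    by (intro measure_pmf.prob_eq_1 [THEN iffD2, symmetric]) (auto simp: AE_measure_pmf_iff)
  also have "\<dots> \<le> measure_pmf.prob M G + (measure_pmf.prob M {S. \<not> F1 S \<le> r1\<^sup>2}
    + (measure_pmf.prob M {S. \<not> F2 S \<le> r2\<^sup>2} + measure_pmf.prob M {S. \<not> F3 S \<le> (e * s)\<^sup>2}))"
    by (intro order_trans [OF measure_Un_le] add_left_mono) auto
  also have "\<dots> \<le> measure_pmf.prob M G + (16 / (e ^ 4 * s) + (2960 / (e ^ 4 * s) + 4 / (e ^ 4 * s)))"
    using B1 B2 B3 by (intro add_mono order_refl)
  also have "16 / (e ^ 4 * s) + (2960 / (e ^ 4 * s) + 4 / (e ^ 4 * s)) = 2980 / (e ^ 4 * s)"
    by (simp add: add_divide_distrib [symmetric])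
  finally show ?thesis unfolding G_def s_def by linarith
qed

theorem theorem8:
  shows "\<exists>c::real. c > 0 \<and>
    (\<forall>(n::nat) (A::real mat) (\<epsilon>::real) (\<delta>::real) (s::real).
      A \<in> carrier_mat n n \<longrightarrow> transpose_mat A = A \<longrightarrow> max_entry_norm A \<le> 1 \<longrightarrow>
      \<epsilon> \<in> {0<..<1} \<longrightarrow> \<delta> \<in> {0<..<1} \<longrightarrow> 0 < s \<longrightarrow> s \<le> real n \<longrightarrow>
      s \<ge> c * log1 (real n) / (\<epsilon> ^ 4 * \<delta>) \<longrightarrow>
      measure_pmf.prob (random_subset n (s / real n))
        {S. \<forall>i\<in>{1..n}. eig A i - \<epsilon> * real n \<le> approx_eig A s S i \<and>
                        approx_eig A s S i \<le> eig A i + \<epsilon> * real n} \<ge> 1 - \<delta>)"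
proof (intro exI [of _ "2000000"] conjI allI impI) \<comment> \<open>at least \<open>2980 * 5 ^ 4\<close>\<close>
  fix n :: nat and A :: "real mat" and \<epsilon> \<delta> s :: real
  assume A: "A \<in> carrier_mat n n" and sym: "transpose_mat A = A" and norm: "max_entry_norm A \<le> 1"
    and "\<epsilon> \<in> {0<..<1}" "\<delta> \<in> {0<..<1}" and s: "0 < s" "s \<le> real n"
    and large: "s \<ge> 2000000 * log1 (real n) / (\<epsilon> ^ 4 * \<delta>)"
  then have \<epsilon>: "0 < \<epsilon>" "\<epsilon> < 1" and \<delta>: "0 < \<delta>" "\<delta> < 1" by auto
  have n: "real n > 0" using s by linarith
  have A1: "\<bar>A $$ (i, k)\<bar> \<le> 1" if "i < n" "k < n" for i k
  proof -
    have "{\<bar>A $$ (i, j)\<bar> | i j. i < dim_row A \<and> j < dim_col A}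
        = (\<lambda>(i, j). \<bar>A $$ (i, j)\<bar>) ` ({..<dim_row A} \<times> {..<dim_col A})" by auto
    then have "finite {\<bar>A $$ (i, j)\<bar> | i j. i < dim_row A \<and> j < dim_col A}" by simp
    then have "\<bar>A $$ (i, k)\<bar> \<le> max_entry_norm A"
      unfolding max_entry_norm_def using that A by (intro Max_ge) auto
    then show ?thesis using norm by simp
  qed
  \<comment> \<open>The convention for the logarithm makes \<open>log1\<close> at least 1.\<close>
  have "2000000 / (\<epsilon> ^ 4 * \<delta>) \<le> 2000000 * log1 (real n) / (\<epsilon> ^ 4 * \<delta>)"
    using \<epsilon> \<delta> by (intro divide_right_mono) (auto simp: log1_def)
  then have "2000000 / (\<epsilon> ^ 4 * \<delta>) \<le> s" using large by linarith
  then have L: "2000000 \<le> \<epsilon> ^ 4 * s * \<delta>" using \<epsilon> \<delta> by (simp add: divide_le_eq mult_ac)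
  have pos: "\<epsilon> ^ 4 * s > 0" using \<epsilon> s by simp
  have "\<epsilon> ^ 4 * s * \<delta> \<le> \<epsilon> ^ 4 * s" using pos \<delta> by (intro mult_left_le) auto
  then have large': "1 \<le> (\<epsilon> / 5) ^ 4 * (s / real n * real n)"
    using L n by (simp add: power_divide)
  have prob: "1 - 2980 / ((\<epsilon> / 5) ^ 4 * (s / real n * real n)) \<le>
    measure_pmf.prob (random_subset n (s / real n)) {S. \<forall>i\<in>{1..n}.
      \<bar>approx_eig A (s / real n * real n) S i - eig A i\<bar> \<le> 5 * (\<epsilon> / 5) * real n}"
    using \<epsilon> s n by (intro sampled_eigenvalues_close_prob A sym A1 large') auto
  \<comment> \<open>\<open>1862500 = 2980 * 5 ^ 4\<close>.\<close>
  have "2980 / ((\<epsilon> / 5) ^ 4 * (s / real n * real n)) = 1862500 / (\<epsilon> ^ 4 * s)"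
    using n by (simp add: power_divide)
  also have "\<dots> \<le> \<delta>" using L pos by (simp add: divide_le_eq mult_ac)
  finally have "1 - \<delta> \<le> measure_pmf.prob (random_subset n (s / real n)) {S. \<forall>i\<in>{1..n}.
      \<bar>approx_eig A s S i - eig A i\<bar> \<le> \<epsilon> * real n}" using prob n by simp
  also have "{S. \<forall>i\<in>{1..n}. \<bar>approx_eig A s S i - eig A i\<bar> \<le> \<epsilon> * real n}
    = {S. \<forall>i\<in>{1..n}. eig A i - \<epsilon> * real n \<le> approx_eig A s S i \<and>
                        approx_eig A s S i \<le> eig A i + \<epsilon> * real n}"
    by (auto simp: abs_le_iff)
  finally show "measure_pmf.prob (random_subset n (s / real n))
        {S. \<forall>i\<in>{1..n}. eig A i - \<epsilon> * real n \<le> approx_eig A s S i \<and>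
                        approx_eig A s S i \<le> eig A i + \<epsilon> * real n} \<ge> 1 - \<delta>" .
qed simp

end
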